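(* For a positive integer $m$, let $f(m)$ be the minimum number of copies of $C_4$ in a graph $G$ with exactly $m$ edges and $\lambda(G) > \sqrt{m}$. Then every graph with $m$ edges and $\lambda(G)>\sqrt{m}$ contains at least $(\frac{1}{8}-o(1))m^2$ copies of $C_4$, and the constant $\frac18$ is optimal; that is, $\lim_{m\to\infty} \frac{f(m)}{m^2} = \frac{1}{8}$.
   Context: All graphs are finite, simple and undirected; $\lambda(G)$ denotes the largest eigenvalue of the adjacency matrix of $G$. A copy of $C_4$ in $G$ is a (not necessarily induced) subgraph of $G$ isomorphic to the $4$-cycle. *)

theory Defs
  imports Complex_Main "Jordan_Normal_Form.Char_Poly"
begin

type_synonym 'a sgraph = "'a set \<times> 'a set set"

abbreviation verts :: "'a sgraph \<Rightarrow> 'a set" where "verts \<equiv> fst"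

abbreviation edges :: "'a sgraph \<Rightarrow> 'a set set" where "edges \<equiv> snd"

definition simple_graph :: "'a sgraph \<Rightarrow> bool" where
  "simple_graph G \<longleftrightarrow> finite (verts G) \<and> (\<forall>e\<in>edges G. e \<subseteq> verts G \<and> card e = 2)"

text \<open>The rows and columns follow an arbitrary enumeration of the (finite) vertex set; the
  eigenvalues do not depend on its choice.\<close>

definition vertex_list :: "'a sgraph \<Rightarrow> 'a list" where
  "vertex_list G = (SOME vs. distinct vs \<and> set vs = verts G)"

definition adj_matrix :: "'a sgraph \<Rightarrow> real mat" where
  "adj_matrix G = mat (card (verts G)) (card (verts G))
     (\<lambda>(i, j). if {vertex_list G ! i, vertex_list G ! j} \<in> edges G then 1 else 0)"

text \<open>A real symmetric matrix has only real eigenvalues, so it suffices to consider real ones.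
  The maximum is meaningful for every graph with at least one vertex.\<close>

definition largest_eigenvalue :: "'a sgraph \<Rightarrow> real" where
  "largest_eigenvalue G = Max {\<mu>. eigenvalue (adj_matrix G) \<mu>}"

definition subgraph :: "'a sgraph \<Rightarrow> 'a sgraph \<Rightarrow> bool" where
  "subgraph H G \<longleftrightarrow> simple_graph H \<and> verts H \<subseteq> verts G \<and> edges H \<subseteq> edges G"

definition graph_iso :: "'a sgraph \<Rightarrow> 'b sgraph \<Rightarrow> bool" where
  "graph_iso G H \<longleftrightarrow>
     (\<exists>\<phi>. bij_betw \<phi> (verts G) (verts H) \<and> edges H = (\<lambda>e. \<phi> ` e) ` edges G)"

definition C4 :: "nat sgraph" where
  "C4 = ({0, 1, 2, 3}, {{0, 1}, {1, 2}, {2, 3}, {3, 0}})"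

definition num_C4 :: "'a sgraph \<Rightarrow> nat" where
  "num_C4 G = card {H. subgraph H G \<and> graph_iso H C4}"

text \<open>Every finite graph is isomorphic to one whose vertices are natural numbers. The infimum of a
  nonempty set of naturals is its minimum. For the empty set (no admissible graph, as for
  \<open>m = 1, 2\<close>) it is a fixed unspecified number, which does not affect the limit.\<close>

definition min_C4 :: "nat \<Rightarrow> nat" where
  "min_C4 m = Inf {num_C4 G | G :: nat sgraph.
     simple_graph G \<and> card (edges G) = m \<and> largest_eigenvalue G > sqrt (real m)}"

end

(*
  The number of 4-cycles is (1/8) * (sum of c^2 - c over ordered pairs of distinct vertices), where c is
  the codegree. Let x be a unit eigenvector for lambda > sqrt m.

  If no coordinate of x is large, then vertices of degree at least s m are few and carry little of the
  mass of A x, so the codegrees through the remaining vertices satisfy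
  sum c x_u x_v >= (1 - O(s)) m. Hence sum c^2 >= (1 - O(s)) m^2, while the sum of these c is only
  O(s m^2).

  If the largest coordinate x_v is of constant size, then lambda^2 |x_u| <= sum_t c_ut |x_t|, and only
  boundedly many t matter. Since these t have total degree at most m + O(1), comparison with
  lambda^2 > m shows that almost all edges go from the set T of near-maximal coordinates to the common
  neighbourhood of T. For |T| >= 2 the codegrees inside T give (1 - o(1)) m^2 / 8 cycles. For |T| = 1
  the graph is almost a star, and then lambda^2 <= m, a contradiction.

  Optimality: the join of K_2 with t independent vertices has 2t + 1 edges, satisfies
  lambda^2 = lambda + 2t, and contains (t choose 2) copies of C4.
*)

theory Submission
  imports Defs "Jordan_Normal_Form.Spectral_Radius" "HOL-Analysis.L2_Norm"
begin

subsection \<open>Eigenvectors of the adjacency matrix\<close>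

definition adj :: "'a sgraph \<Rightarrow> 'a \<Rightarrow> 'a \<Rightarrow> real" where
  "adj G u v = of_bool ({u, v} \<in> edges G)"

lemma adj_sym: "adj G u v = adj G v u"
  by (simp add: adj_def insert_commute)

lemma adj_self: "simple_graph G \<Longrightarrow> adj G u u = 0"
  by (auto simp: adj_def simple_graph_def)

lemma adj_matrix_carrier: "adj_matrix G \<in> carrier_mat (card (verts G)) (card (verts G))"
  by (simp add: adj_matrix_def)

lemma vertex_list_props:
  assumes "simple_graph G"
  shows "distinct (vertex_list G)" "set (vertex_list G) = verts G"
    "length (vertex_list G) = card (verts G)"
proof -
  have "finite (verts G)" using assms by (simp add: simple_graph_def)
  then have "\<exists>vs. distinct vs \<and> set vs = verts G"
    using finite_distinct_list by metis
  then have "distinct (vertex_list G) \<and> set (vertex_list G) = verts G"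
    unfolding vertex_list_def by (rule someI_ex)
  then show *: "distinct (vertex_list G)" "set (vertex_list G) = verts G"
    by (rule conjunct1, rule conjunct2)
  show "length (vertex_list G) = card (verts G)"
    using distinct_card[OF *(1)] *(2) by simp
qed

lemma bij_betw_vertex_list:
  assumes "simple_graph G"
  shows "bij_betw ((!) (vertex_list G)) {..<card (verts G)} (verts G)"
  using vertex_list_props[OF assms] by (intro bij_betw_nth) auto

lemma adj_matrix_mult_vec:
  assumes G: "simple_graph G" and i: "i < card (verts G)"
  shows "(adj_matrix G *\<^sub>v vec (card (verts G)) (\<lambda>j. x (vertex_list G ! j))) $ i =
    (\<Sum>v\<in>verts G. adj G (vertex_list G ! i) v * x v)"
proof -
  have "(adj_matrix G *\<^sub>v vec (card (verts G)) (\<lambda>j. x (vertex_list G ! j))) $ i =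
    (\<Sum>j<card (verts G). adj G (vertex_list G ! i) (vertex_list G ! j) * x (vertex_list G ! j))"
    using i by (simp add: adj_matrix_def scalar_prod_def atLeast0LessThan adj_def of_bool_def)
  also have "\<dots> = (\<Sum>v\<in>verts G. adj G (vertex_list G ! i) v * x v)"
    by (rule sum.reindex_bij_betw[OF bij_betw_vertex_list[OF G]])
  finally show ?thesis .
qed

text \<open>Transfers eigenvectors from positions in \<open>vertex_list G\<close> to functions on
  the vertices, so that the later arguments never meet the enumeration.\<close>

lemma eigenvalue_adj_matrix_iff:
  assumes G: "simple_graph G"
  shows "eigenvalue (adj_matrix G) \<mu> \<longleftrightarrow>
    (\<exists>x. (\<exists>u\<in>verts G. x u \<noteq> 0) \<and> (\<forall>u\<in>verts G. (\<Sum>v\<in>verts G. adj G u v * x v) = \<mu> * x u))"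
    (is "_ \<longleftrightarrow> ?R")
proof
  let ?n = "card (verts G)" and ?l = "(!) (vertex_list G)"
  let ?g = "inv_into {..<?n} ?l"
  note bij = bij_betw_vertex_list[OF G]
  have image: "\<exists>j<?n. u = ?l j" if "u \<in> verts G" for u
    using that bij_betw_imp_surj_on[OF bij] by (metis imageE lessThan_iff)
  have dim: "dim_row (adj_matrix G) = ?n" by (simp add: adj_matrix_def)
  {
    assume "eigenvalue (adj_matrix G) \<mu>"
    then obtain w where w: "w \<in> carrier_vec ?n" "w \<noteq> 0\<^sub>v ?n" "adj_matrix G *\<^sub>v w = \<mu> \<cdot>\<^sub>v w"
      unfolding eigenvalue_def eigenvector_def dim by blast
    define x where "x u = w $ ?g u" for u
    have xl: "x (?l j) = w $ j" if "j < ?n" for j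
      using that bij by (simp add: x_def bij_betw_def inv_into_f_f)
    have wx: "w = vec ?n (\<lambda>j. x (?l j))"
      using w(1) xl by (intro eq_vecI) auto
    obtain i where i: "i < ?n" "w $ i \<noteq> 0"
      using w(1,2) by (metis carrier_vecD eq_vecI index_zero_vec(1) index_zero_vec(2))
    have l: "?l j \<in> verts G" if "j < ?n" for j
      using bij that unfolding bij_betw_def by blast
    have "(\<Sum>v\<in>verts G. adj G u v * x v) = \<mu> * x u" if u: "u \<in> verts G" for u
    proof -
      obtain j where j: "j < ?n" "u = ?l j"
        using image[OF u] by blast
      have "\<mu> * x u = (\<mu> \<cdot>\<^sub>v w) $ j" using w(1) j xl by simp
      then show ?thesis
        using adj_matrix_mult_vec[OF G j(1), of x] j(2) unfolding wx[symmetric] w(3) by metis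
    qed
    then show ?R using i xl[OF i(1)] l[OF i(1)] by metis
  next
    assume ?R
    then obtain x u where x: "u \<in> verts G" "x u \<noteq> 0"
      "\<And>u. u\<in>verts G \<Longrightarrow> (\<Sum>v\<in>verts G. adj G u v * x v) = \<mu> * x u" by blast
    define w where "w = vec ?n (\<lambda>j. x (?l j))"
    obtain j where j: "j < ?n" "u = ?l j"
      using image[OF x(1)] by blast
    have l: "?l j \<in> verts G" if "j < ?n" for j
      using bij that unfolding bij_betw_def by blast
    have "w \<noteq> 0\<^sub>v ?n"
      using j x(2) by (metis index_vec index_zero_vec(1) w_def)
    moreover have "adj_matrix G *\<^sub>v w = \<mu> \<cdot>\<^sub>v w"
    proof (rule eq_vecI)
      fix i assume "i < dim_vec (\<mu> \<cdot>\<^sub>v w)"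
      then have i: "i < ?n" by (simp add: w_def)
      then show "(adj_matrix G *\<^sub>v w) $ i = (\<mu> \<cdot>\<^sub>v w) $ i"
        unfolding w_def adj_matrix_mult_vec[OF G i] using x(3)[OF l[OF i]] by simp
    qed (simp add: w_def dim)
    ultimately show "eigenvalue (adj_matrix G) \<mu>"
      unfolding eigenvalue_def eigenvector_def dim w_def by (metis vec_carrier)
  }
qed

lemma finite_eigenvalues: "finite {\<mu>. eigenvalue (adj_matrix G) \<mu>}"
  using card_finite_spectrum(1)[OF adj_matrix_carrier[of G]] by (simp add: spectrum_def)

text \<open>An eigenvalue exists over the complex numbers. For its eigenvector \<open>w\<close> the
  form \<open>?S\<close> equals \<open>\<mu>\<close> times the squared norm of \<open>w\<close>;
  symmetry makes \<open>?S\<close> real, hence also \<open>\<mu>\<close>. This is what gives the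
  maximum in \<open>largest_eigenvalue\<close> a nonempty range.\<close>

lemma symmetric_real_eigenvalue_exists:
  fixes A :: "real mat"
  assumes A: "A \<in> carrier_mat n n" and n: "n > 0"
    and sym: "\<And>i j. i < n \<Longrightarrow> j < n \<Longrightarrow> A $$ (i, j) = A $$ (j, i)"
  shows "\<exists>\<mu>. eigenvalue A \<mu>"
proof -
  let ?B = "map_mat complex_of_real A"
  have B: "?B \<in> carrier_mat n n" using A by simp
  from spectrum_non_empty[OF B n] obtain \<mu> where ev: "eigenvalue ?B \<mu>"
    by (auto simp: spectrum_def)
  then obtain w where w: "w \<in> carrier_vec n" "w \<noteq> 0\<^sub>v n" "?B *\<^sub>v w = \<mu> \<cdot>\<^sub>v w"
    using A unfolding eigenvalue_def eigenvector_def by auto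
  let ?a = "\<lambda>i j. complex_of_real (A $$ (i, j))"
  have eq: "(\<Sum>j<n. ?a i j * w $ j) = \<mu> * w $ i" if "i < n" for i
  proof -
    have "(?B *\<^sub>v w) $ i = (\<Sum>j<n. ?a i j * w $ j)"
      using that A w(1) by (auto simp: scalar_prod_def atLeast0LessThan)
    then show ?thesis using w that by simp
  qed
  let ?N = "\<Sum>i<n. (cmod (w $ i))\<^sup>2"
  let ?S = "\<Sum>i<n. \<Sum>j<n. cnj (w $ i) * ?a i j * w $ j"
  have S: "?S = \<mu> * of_real ?N"
  proof -
    have "?S = (\<Sum>i<n. cnj (w $ i) * (\<mu> * w $ i))"
      by (intro sum.cong refl) (simp flip: eq add: sum_distrib_left mult.assoc)
    also have "\<dots> = \<mu> * of_real ?N"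
      unfolding of_real_sum sum_distrib_left
      by (intro sum.cong refl) (metis complex_norm_square mult.assoc mult.commute)
    finally show ?thesis .
  qed
  have "cnj ?S = (\<Sum>i<n. \<Sum>j<n. cnj (w $ j) * ?a j i * w $ i)"
    by (simp, intro sum.cong refl) (simp add: sym mult_ac)
  also have "\<dots> = ?S" by (rule sum.swap)
  finally have "cnj (\<mu> * of_real ?N) = \<mu> * of_real ?N" unfolding S .
  then have "(cnj \<mu> - \<mu>) * of_real ?N = 0" by (simp add: algebra_simps)
  moreover have "?N > 0"
  proof -
    obtain i where i: "i < n" "w $ i \<noteq> 0"
      using w(1,2) by (metis carrier_vecD eq_vecI index_zero_vec(1) index_zero_vec(2))
    then show ?thesis by (intro sum_pos2[of _ i]) auto
  qed
  ultimately have "cnj \<mu> = \<mu>"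
    by (metis less_irrefl mult_eq_0_iff of_real_eq_0_iff right_minus_eq)
  then obtain r where r: "\<mu> = complex_of_real r"
    by (metis Reals_cases Reals_cnj_iff)
  \<comment> \<open>Being a root of the characteristic polynomial passes from complex to real, so no
    real eigenvector has to be extracted from \<open>w\<close>.\<close>
  have "poly (char_poly ?B) \<mu> = 0" using ev eigenvalue_root_char_poly[OF B] by simp
  then have "of_real (poly (char_poly A) r) = (0 :: complex)"
    unfolding of_real_hom.char_poly_hom[OF A] r by simp
  then show ?thesis using eigenvalue_root_char_poly[OF A] by auto
qed

lemma eigenvalue_largest_eigenvalue:
  assumes "simple_graph G" "verts G \<noteq> {}"
  shows "eigenvalue (adj_matrix G) (largest_eigenvalue G)"
proof -
  have "card (verts G) > 0"
    using assms by (simp add: simple_graph_def card_gt_0_iff)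
  then have "\<exists>\<mu>. eigenvalue (adj_matrix G) \<mu>"
    by (intro symmetric_real_eigenvalue_exists[OF adj_matrix_carrier])
       (auto simp: adj_matrix_def insert_commute)
  then show ?thesis
    using Max_in[OF finite_eigenvalues[of G]] unfolding largest_eigenvalue_def by blast
qed

lemma eigenvalue_le_largest_eigenvalue:
  "eigenvalue (adj_matrix G) \<mu> \<Longrightarrow> \<mu> \<le> largest_eigenvalue G"
  unfolding largest_eigenvalue_def by (rule Max_ge[OF finite_eigenvalues]) simp

subsection \<open>Counting 4-cycles by codegrees\<close>

text \<open>The arguments run around the cycle, so \<open>u\<close>, \<open>v\<close> and
  \<open>w\<close>, \<open>z\<close> are the two pairs of opposite vertices.\<close>

definition cycle4 :: "'a \<Rightarrow> 'a \<Rightarrow> 'a \<Rightarrow> 'a \<Rightarrow> 'a sgraph" where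
  "cycle4 u w v z = ({u, w, v, z}, {{u, w}, {w, v}, {v, z}, {z, u}})"

text \<open>Simplicity keeps every edge inside the vertex set, so the inverse of an isomorphism
  carries the edges of \<open>C4\<close> back onto those of \<open>H\<close>; the images of 0, 1, 2,
  3 are then the vertices in cyclic order.\<close>

lemma graph_iso_C4_iff:
  assumes H: "simple_graph H"
  shows "graph_iso H C4 \<longleftrightarrow> (\<exists>u w v z. distinct [u, w, v, z] \<and> H = cycle4 u w v z)"
proof
  assume "graph_iso H C4"
  then obtain \<phi> where bij: "bij_betw \<phi> (verts H) (verts C4)"
    and ed: "edges C4 = (\<lambda>e. \<phi> ` e) ` edges H"
    unfolding graph_iso_def by blast
  let ?\<psi> = "inv_into (verts H) \<phi>"
  have bij': "bij_betw ?\<psi> (verts C4) (verts H)" by (rule bij_betw_inv_into[OF bij])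
  have V: "verts H = ?\<psi> ` {0, 1, 2, 3}"
    using bij' by (simp add: bij_betw_def C4_def)
  have "(\<lambda>e. ?\<psi> ` e) ` edges C4 = (\<lambda>e. ?\<psi> ` \<phi> ` e) ` edges H"
    unfolding ed by (simp add: image_image)
  also have "\<dots> = id ` edges H"
  proof (rule image_cong[OF refl])
    fix e assume "e \<in> edges H"
    then have "e \<subseteq> verts H" using H by (simp add: simple_graph_def)
    then show "?\<psi> ` \<phi> ` e = id e"
      using bij by (simp add: bij_betw_def inv_into_image_cancel)
  qed
  finally have E: "edges H = (\<lambda>e. ?\<psi> ` e) ` edges C4" by simp
  have "inj_on ?\<psi> {0, 1, 2, 3}" using bij' by (simp add: bij_betw_def C4_def)
  then have "distinct [?\<psi> 0, ?\<psi> 1, ?\<psi> 2, ?\<psi> 3]" by (auto simp: inj_on_def)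
  moreover have "H = cycle4 (?\<psi> 0) (?\<psi> 1) (?\<psi> 2) (?\<psi> 3)"
    unfolding cycle4_def by (rule prod_eqI) (use V E in \<open>simp_all add: C4_def\<close>)
  ultimately show "\<exists>u w v z. distinct [u, w, v, z] \<and> H = cycle4 u w v z" by blast
next
  assume "\<exists>u w v z. distinct [u, w, v, z] \<and> H = cycle4 u w v z"
  then obtain u w v z where d: "distinct [u, w, v, z]" and Hc: "H = cycle4 u w v z" by blast
  define \<phi> where "\<phi> t = (if t = u then 0 else if t = w then 1 else if t = v then 2 else (3 :: nat))" for t
  have \<phi>: "\<phi> u = 0" "\<phi> w = 1" "\<phi> v = 2" "\<phi> z = 3" using d by (auto simp: \<phi>_def)
  have "bij_betw \<phi> (verts H) (verts C4)"
    using d unfolding bij_betw_def inj_on_def Hc cycle4_def C4_def by (simp add: \<phi>)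
  moreover have "edges C4 = (\<lambda>e. \<phi> ` e) ` edges H"
    by (simp add: Hc cycle4_def C4_def \<phi>)
  ultimately show "graph_iso H C4" unfolding graph_iso_def by blast
qed

lemma simple_graph_cycle4: "distinct [u, w, v, z] \<Longrightarrow> simple_graph (cycle4 u w v z)"
  by (auto simp: simple_graph_def cycle4_def)

lemma C4_copies_eq:
  assumes G: "simple_graph G"
  shows "{H. subgraph H G \<and> graph_iso H C4} =
    {cycle4 u w v z | u w v z. distinct [u, w, v, z] \<and>
       {u, w} \<in> edges G \<and> {w, v} \<in> edges G \<and> {v, z} \<in> edges G \<and> {z, u} \<in> edges G}"
    (is "?L = ?R")
proof (intro equalityI subsetI)
  fix H assume "H \<in> ?L"
  then have H: "simple_graph H" "edges H \<subseteq> edges G" "graph_iso H C4"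
    by (auto simp: subgraph_def)
  then obtain u w v z where d: "distinct [u, w, v, z]" "H = cycle4 u w v z"
    using graph_iso_C4_iff by blast
  moreover have "{u, w} \<in> edges G" "{w, v} \<in> edges G" "{v, z} \<in> edges G" "{z, u} \<in> edges G"
    using H(2) unfolding d(2) cycle4_def by simp_all
  ultimately show "H \<in> ?R" by blast
next
  fix H assume "H \<in> ?R"
  then obtain u w v z where d: "distinct [u, w, v, z]" "H = cycle4 u w v z"
    "{u, w} \<in> edges G" "{w, v} \<in> edges G" "{v, z} \<in> edges G" "{z, u} \<in> edges G" by blast
  have "{u, w} \<subseteq> verts G" "{v, z} \<subseteq> verts G"
    using d G unfolding simple_graph_def by blast+
  then have "verts H \<subseteq> verts G" "edges H \<subseteq> edges G"
    using d unfolding cycle4_def by auto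
  moreover have "simple_graph H" using d simple_graph_cycle4 by metis
  ultimately show "H \<in> ?L" using d graph_iso_C4_iff[of H] unfolding subgraph_def by blast
qed

lemma finite_C4_copies:
  assumes "simple_graph G"
  shows "finite {H. subgraph H G \<and> graph_iso H C4}"
proof (rule finite_subset)
  show "{H. subgraph H G \<and> graph_iso H C4} \<subseteq> Pow (verts G) \<times> Pow (Pow (verts G))"
  proof
    fix H assume "H \<in> {H. subgraph H G \<and> graph_iso H C4}"
    then have H: "verts H \<subseteq> verts G" "\<forall>e\<in>edges H. e \<subseteq> verts H"
      unfolding subgraph_def simple_graph_def by blast+
    then have "edges H \<subseteq> Pow (verts G)" by blast
    then show "H \<in> Pow (verts G) \<times> Pow (Pow (verts G))" using H(1) by (simp add: mem_Times_iff)
  qed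
  show "finite (Pow (verts G) \<times> Pow (Pow (verts G)))"
    using assms by (simp add: simple_graph_def)
qed

section \<open>Marking 4-cycles by their diagonals\<close>

definition common_nbrs :: "'a sgraph \<Rightarrow> 'a set \<Rightarrow> 'a \<Rightarrow> 'a \<Rightarrow> 'a set" where
  "common_nbrs G S u v = {w \<in> S. {u, w} \<in> edges G \<and> {w, v} \<in> edges G}"

text \<open>A tuple \<open>(u, v, w, z)\<close> marks a 4-cycle by an ordered diagonal with ends in
  \<open>T\<close>, followed by the other diagonal, also ordered, with ends in
  \<open>S\<close>.\<close>

definition diag_tuples :: "'a sgraph \<Rightarrow> 'a set \<Rightarrow> 'a set \<Rightarrow> ('a \<times> 'a \<times> 'a \<times> 'a) set" where
  "diag_tuples G T S = (SIGMA u:T. SIGMA v:T - {u}. SIGMA w:common_nbrs G S u v.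
     common_nbrs G S u v - {w})"

lemma card_diag_tuples:
  assumes "finite T" "finite S"
  shows "card (diag_tuples G T S) =
    (\<Sum>u\<in>T. \<Sum>v\<in>T - {u}. card (common_nbrs G S u v) * (card (common_nbrs G S u v) - 1))"
proof -
  have [simp]: "finite (common_nbrs G S u v)" for u v
    using assms(2) by (simp add: common_nbrs_def)
  show ?thesis using assms(1)
    unfolding diag_tuples_def by (simp add: card_Diff_singleton)
qed

text \<open>The eight tuples are the symmetries of the square: exchanging the diagonals and
  reversing either of them.\<close>

lemma cycle4_eq_cases:
  assumes "distinct [u, w, v, z]" "distinct [u', w', v', z']"
    and "cycle4 u' w' v' z' = cycle4 u w v z"
  shows "(u', v', w', z') \<in> {(u, v, w, z), (v, u, w, z), (u, v, z, w), (v, u, z, w),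
     (w, z, u, v), (z, w, u, v), (w, z, v, u), (z, w, v, u)}"
proof -
  have eq: "{{u', w'}, {w', v'}, {v', z'}, {z', u'}} = {{u, w}, {w, v}, {v, z}, {z, u}}"
    using assms(3) unfolding cycle4_def by (rule Pair_inject)
  have "{u', w'} \<in> {{u, w}, {w, v}, {v, z}, {z, u}}" "{w', v'} \<in> {{u, w}, {w, v}, {v, z}, {z, u}}"
    "{v', z'} \<in> {{u, w}, {w, v}, {v, z}, {z, u}}"
    using eq by (metis insertI1 insertI2)+
  then have 1: "(u' = u \<and> w' = w) \<or> (u' = w \<and> w' = u) \<or> (u' = w \<and> w' = v) \<or> (u' = v \<and> w' = w) \<or>
      (u' = v \<and> w' = z) \<or> (u' = z \<and> w' = v) \<or> (u' = z \<and> w' = u) \<or> (u' = u \<and> w' = z)"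
    and 2: "(w' = u \<and> v' = w) \<or> (w' = w \<and> v' = u) \<or> (w' = w \<and> v' = v) \<or> (w' = v \<and> v' = w) \<or>
      (w' = v \<and> v' = z) \<or> (w' = z \<and> v' = v) \<or> (w' = z \<and> v' = u) \<or> (w' = u \<and> v' = z)"
    and 3: "(v' = u \<and> z' = w) \<or> (v' = w \<and> z' = u) \<or> (v' = w \<and> z' = v) \<or> (v' = v \<and> z' = w) \<or>
      (v' = v \<and> z' = z) \<or> (v' = z \<and> z' = v) \<or> (v' = z \<and> z' = u) \<or> (v' = u \<and> z' = z)"
    by (simp_all add: doubleton_eq_iff)
  have d: "u \<noteq> w" "u \<noteq> v" "u \<noteq> z" "w \<noteq> v" "w \<noteq> z" "v \<noteq> z" "u' \<noteq> v'" "w' \<noteq> z'"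
    using assms(1,2) by auto
  \<comment> \<open>The position of the edge \<open>{u', w'}\<close> leaves eight cases; in each,
    the next two edges and the distinctness of opposite vertices determine \<open>v'\<close> and
    \<open>z'\<close>.\<close>
  from 1 show ?thesis
    by (elim disjE conjE) (use d 2 3 in \<open>simp; elim disjE conjE; simp\<close>)+
qed

lemma card_le_fibres:
  assumes "finite X" "f ` X \<subseteq> C" "finite C"
    and "\<And>x. x \<in> X \<Longrightarrow> card {y \<in> X. f y = f x} \<le> k"
  shows "card X \<le> k * card C"
proof -
  have "X = (\<Union>c\<in>f ` X. {y \<in> X. f y = c})" by auto
  then have "card X \<le> (\<Sum>c\<in>f ` X. card {y \<in> X. f y = c})"
    using card_UN_le[of "f ` X" "\<lambda>c. {y \<in> X. f y = c}"] assms(1) by simp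
  also have "\<dots> \<le> (\<Sum>c\<in>f ` X. k)" using assms(4) by (intro sum_mono) auto
  also have "\<dots> = k * card (f ` X)" by simp
  also have "\<dots> \<le> k * card C" using assms(2,3) by (intro mult_left_mono card_mono) auto
  finally show ?thesis .
qed

text \<open>A cycle is marked at most once per symmetry of the square. If \<open>T\<close> and
  \<open>S\<close> are disjoint, its diagonals cannot be exchanged, and at most four markings
  remain.\<close>

lemma card_diag_tuples_le:
  assumes G: "simple_graph G" and T: "T \<subseteq> verts G" and S: "S \<subseteq> verts G"
  shows "card (diag_tuples G T S) \<le> 8 * num_C4 G"
    and "T \<inter> S = {} \<Longrightarrow> card (diag_tuples G T S) \<le> 4 * num_C4 G"
proof -
  let ?X = "diag_tuples G T S"
  let ?f = "\<lambda>(u, v, w, z). cycle4 u w v z"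
  have fin: "finite T" "finite S"
    using G T S finite_subset unfolding simple_graph_def by metis+
  have finX: "finite ?X"
    using fin unfolding diag_tuples_def common_nbrs_def by auto
  have memX: "u \<in> T \<and> v \<in> T \<and> w \<in> S \<and> z \<in> S \<and> distinct [u, w, v, z] \<and> {u, w} \<in> edges G \<and>
      {w, v} \<in> edges G \<and> {v, z} \<in> edges G \<and> {z, u} \<in> edges G" if "(u, v, w, z) \<in> ?X" for u v w z
  proof -
    have e: "{u, w} \<in> edges G" "{w, v} \<in> edges G" "{v, z} \<in> edges G" "{z, u} \<in> edges G"
      "u \<noteq> v" "w \<noteq> z" "u \<in> T" "v \<in> T" "w \<in> S" "z \<in> S"
      using that unfolding diag_tuples_def common_nbrs_def by (auto simp: insert_commute)
    moreover have "card {u, w} = 2" "card {w, v} = 2" "card {v, z} = 2" "card {z, u} = 2"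
      using G e unfolding simple_graph_def by blast+
    ultimately show ?thesis by auto
  qed
  have img: "?f ` ?X \<subseteq> {H. subgraph H G \<and> graph_iso H C4}"
  proof
    fix H assume "H \<in> ?f ` ?X"
    then obtain u v w z where x: "(u, v, w, z) \<in> ?X" "H = cycle4 u w v z" by auto
    show "H \<in> {H. subgraph H G \<and> graph_iso H C4}"
      unfolding C4_copies_eq[OF G] using memX[OF x(1)] x(2) by blast
  qed
  have fib: "{y \<in> ?X. ?f y = ?f (u, v, w, z)} \<subseteq>
     {(u, v, w, z), (v, u, w, z), (u, v, z, w), (v, u, z, w),
     (w, z, u, v), (z, w, u, v), (w, z, v, u), (z, w, v, u)}" (is "_ \<subseteq> ?F")
    if x: "(u, v, w, z) \<in> ?X" for u v w z
  proof
    fix y assume y: "y \<in> {y \<in> ?X. ?f y = ?f (u, v, w, z)}"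
    obtain u' v' w' z' where yy: "y = (u', v', w', z')" by (metis prod_cases4)
    show "y \<in> ?F" unfolding yy
      using y memX[OF x] memX[of u' v' w' z'] unfolding yy by (intro cycle4_eq_cases) auto
  qed
  show "card ?X \<le> 8 * num_C4 G"
    unfolding num_C4_def
  proof (rule card_le_fibres[OF finX img finite_C4_copies[OF G]])
    fix x assume x: "x \<in> ?X"
    obtain u v w z where xx: "x = (u, v, w, z)" by (metis prod_cases4)
    have "card {y \<in> ?X. ?f y = ?f x} \<le> card (set [(u, v, w, z), (v, u, w, z), (u, v, z, w),
       (v, u, z, w), (w, z, u, v), (z, w, u, v), (w, z, v, u), (z, w, v, u)])"
      using fib[of u v w z] x unfolding xx by (intro card_mono) auto
    also have "\<dots> \<le> 8" by (rule order.trans[OF card_length]) simp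
    finally show "card {y \<in> ?X. ?f y = ?f x} \<le> 8" .
  qed
  show "card ?X \<le> 4 * num_C4 G" if disj: "T \<inter> S = {}"
    unfolding num_C4_def
  proof (rule card_le_fibres[OF finX img finite_C4_copies[OF G]])
    fix x assume x: "x \<in> ?X"
    obtain u v w z where xx: "x = (u, v, w, z)" by (metis prod_cases4)
    have "{y \<in> ?X. ?f y = ?f x} \<subseteq> set [(u, v, w, z), (v, u, w, z), (u, v, z, w), (v, u, z, w)]"
    proof
      fix y assume y: "y \<in> {y \<in> ?X. ?f y = ?f x}"
      obtain u' v' w' z' where yy: "y = (u', v', w', z')" by (metis prod_cases4)
      have "u' \<in> T" "v' \<in> T" "u \<in> T" "v \<in> T" "w' \<in> S" "z' \<in> S" "w \<in> S" "z \<in> S"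
        using memX[of u v w z] memX[of u' v' w' z'] x y unfolding xx yy by auto
      then have "u' \<noteq> w" "u' \<noteq> z" using disj by auto
      moreover have "y \<in> {(u, v, w, z), (v, u, w, z), (u, v, z, w), (v, u, z, w),
          (w, z, u, v), (z, w, u, v), (w, z, v, u), (z, w, v, u)}"
        using fib[OF x[unfolded xx]] y unfolding xx by (rule subsetD)
      ultimately show "y \<in> set [(u, v, w, z), (v, u, w, z), (u, v, z, w), (v, u, z, w)]"
        unfolding yy by auto
    qed
    then have "card {y \<in> ?X. ?f y = ?f x} \<le>
        card (set [(u, v, w, z), (v, u, w, z), (u, v, z, w), (v, u, z, w)])"
      by (intro card_mono) auto
    also have "\<dots> \<le> 4" by (rule order.trans[OF card_length]) simp
    finally show "card {y \<in> ?X. ?f y = ?f x} \<le> 4" .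
  qed
qed

text \<open>A sum of products instead of a cardinality, so that it agrees with \<open>cdeg\<close>
  of the locale below and can be exchanged with other sums.\<close>

definition codeg :: "'a sgraph \<Rightarrow> 'a set \<Rightarrow> 'a \<Rightarrow> 'a \<Rightarrow> real" where
  "codeg G S u v = (\<Sum>w\<in>S. adj G u w * adj G w v)"

lemma codeg_eq_card: "finite S \<Longrightarrow> codeg G S u v = real (card (common_nbrs G S u v))"
  unfolding codeg_def common_nbrs_def adj_def
  by (simp add: sum_of_bool_eq Int_def flip: of_bool_conj)

lemma sum_codeg_le_num_C4:
  assumes G: "simple_graph G" and T: "T \<subseteq> verts G" and S: "S \<subseteq> verts G"
  shows "(\<Sum>u\<in>T. \<Sum>v\<in>T - {u}. (codeg G S u v)\<^sup>2 - codeg G S u v) \<le> 8 * real (num_C4 G)"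
    and "T \<inter> S = {} \<Longrightarrow>
      (\<Sum>u\<in>T. \<Sum>v\<in>T - {u}. (codeg G S u v)\<^sup>2 - codeg G S u v) \<le> 4 * real (num_C4 G)"
proof -
  have fin: "finite T" "finite S"
    using G T S finite_subset unfolding simple_graph_def by metis+
  \<comment> \<open>At \<open>c = 0\<close> the truncated \<open>c - 1\<close> is harmless because
    it is multiplied by \<open>c\<close>.\<close>
  have *: "real (c * (c - 1)) = (real c)\<^sup>2 - real c" for c :: nat
    by (cases c) (auto simp: power2_eq_square algebra_simps)
  have eq: "(\<Sum>u\<in>T. \<Sum>v\<in>T - {u}. (codeg G S u v)\<^sup>2 - codeg G S u v) = real (card (diag_tuples G T S))"
    unfolding card_diag_tuples[OF fin] of_nat_sum * codeg_eq_card[OF fin(2)] ..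
  show "(\<Sum>u\<in>T. \<Sum>v\<in>T - {u}. (codeg G S u v)\<^sup>2 - codeg G S u v) \<le> 8 * real (num_C4 G)"
    unfolding eq using card_diag_tuples_le(1)[OF G T S] by linarith
  show "(\<Sum>u\<in>T. \<Sum>v\<in>T - {u}. (codeg G S u v)\<^sup>2 - codeg G S u v) \<le> 4 * real (num_C4 G)"
    if "T \<inter> S = {}"
    unfolding eq using card_diag_tuples_le(2)[OF G T S that] by linarith
qed

subsection \<open>Almost stars\<close>

text \<open>Sums over edges become sums over ordered pairs of vertices. Each edge is then counted
  twice, so \<open>m\<close> stands for the number of edges.\<close>

locale zero_one_form =
  fixes V :: "'a set" and a :: "'a \<Rightarrow> 'a \<Rightarrow> real" and m :: real
  assumes finite_V: "finite V"
    and zero_one: "a u v = 0 \<or> a u v = 1"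
    and sym: "a u v = a v u"
    and irrefl: "a u u = 0"
    and total: "(\<Sum>u\<in>V. \<Sum>v\<in>V. a u v) = 2 * m"
begin

definition deg :: "'a \<Rightarrow> real" where "deg u = (\<Sum>v\<in>V. a u v)"

definition cdeg :: "'a set \<Rightarrow> 'a \<Rightarrow> 'a \<Rightarrow> real" where
  "cdeg S u v = (\<Sum>w\<in>S. a u w * a w v)"

lemma a_nonneg: "0 \<le> a u v" and a_le_1: "a u v \<le> 1" and a_square: "a u v * a u v = a u v"
  using zero_one[of u v] by auto

lemma a_mult_le: "a u w * a w v \<le> a w v" "a u w * a w v \<le> a u w"
  using zero_one[of u w] zero_one[of w v] by auto

lemma deg_nonneg: "0 \<le> deg u"
  unfolding deg_def by (intro sum_nonneg a_nonneg)

lemma sum_deg: "(\<Sum>u\<in>V. deg u) = 2 * m"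
  unfolding deg_def by (rule total)

lemma m_nonneg: "0 \<le> m"
  using sum_deg sum_nonneg[of V deg] deg_nonneg by simp

lemma cdeg_nonneg: "0 \<le> cdeg S u v"
  unfolding cdeg_def by (intro sum_nonneg mult_nonneg_nonneg a_nonneg)

lemma cdeg_le_deg: "S \<subseteq> V \<Longrightarrow> cdeg S u v \<le> deg v"
proof -
  assume S: "S \<subseteq> V"
  have "cdeg S u v \<le> (\<Sum>w\<in>S. a v w)"
    unfolding cdeg_def by (intro sum_mono) (metis a_mult_le(1) sym)
  also have "\<dots> \<le> deg v"
    unfolding deg_def using S finite_V by (intro sum_mono2) (auto simp: a_nonneg)
  finally show ?thesis .
qed

lemma cdeg_self: "cdeg V u u = deg u"
  unfolding cdeg_def deg_def by (intro sum.cong refl) (metis a_square sym)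

text \<open>Cauchy-Schwarz; the entries equal their own squares, so the squared norm of a row is its
  row sum.\<close>

lemma row_square_le: "(\<Sum>w\<in>S. a u w * x w)\<^sup>2 \<le> (\<Sum>w\<in>S. a u w) * (\<Sum>w\<in>S. (x w)\<^sup>2)"
proof -
  have "\<bar>\<Sum>w\<in>S. a u w * x w\<bar> \<le> (\<Sum>w\<in>S. \<bar>a u w\<bar> * \<bar>x w\<bar>)"
    unfolding abs_mult[symmetric] by (rule sum_abs)
  also have "\<dots> \<le> L2_set (a u) S * L2_set x S" by (rule L2_set_mult_ineq)
  finally have "\<bar>\<Sum>w\<in>S. a u w * x w\<bar>\<^sup>2 \<le> (L2_set (a u) S)\<^sup>2 * (L2_set x S)\<^sup>2"
    unfolding power_mult_distrib[symmetric] by (intro power_mono) auto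
  also have "(L2_set (a u) S)\<^sup>2 = (\<Sum>w\<in>S. a u w)"
    unfolding L2_set_def by (simp add: sum_nonneg power2_eq_square a_square a_nonneg)
  also have "(L2_set x S)\<^sup>2 = (\<Sum>w\<in>S. (x w)\<^sup>2)"
    unfolding L2_set_def by (simp add: sum_nonneg)
  finally show ?thesis by simp
qed

lemma total_remove:
  assumes v: "v \<in> V"
  shows "(\<Sum>u\<in>V - {v}. \<Sum>w\<in>V - {v}. a u w) = 2 * (m - deg v)"
proof -
  note split = sum.remove[OF finite_V v]
  have dv: "deg v = (\<Sum>w\<in>V - {v}. a v w)" unfolding deg_def split by (simp add: irrefl)
  have "2 * m = deg v + ((\<Sum>u\<in>V - {v}. a u v) + (\<Sum>u\<in>V - {v}. \<Sum>w\<in>V - {v}. a u w))"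
    unfolding total[symmetric] split[of "\<lambda>u. \<Sum>w\<in>V. a u w"]
    by (simp add: deg_def split[of "a _"] sum.distrib)
  moreover have "(\<Sum>u\<in>V - {v}. a u v) = deg v" unfolding dv by (simp add: sym)
  ultimately show ?thesis by simp
qed

text \<open>Expanding the eigenvalue equation at a vertex of almost full degree: the few edges missing the
  vertex contribute less to \<open>lam\<^sup>2\<close> than their number.\<close>

lemma star_bound_normalised:
  assumes v: "v \<in> V" and eig: "\<And>u. u \<in> V \<Longrightarrow> (\<Sum>w\<in>V. a u w * x w) = lam * x u"
    and xv: "x v = 1" and lam: "lam > 0" and m: "m \<ge> 16" and dv: "deg v \<ge> 199 / 200 * m"
  shows "lam\<^sup>2 \<le> m"
proof (rule ccontr)
  assume "\<not> lam\<^sup>2 \<le> m"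
  then have lm: "m < lam\<^sup>2" by simp
  define V' where "V' = V - {v}"
  \<comment> \<open>\<open>e\<close> counts the edges missing \<open>v\<close>, \<open>g\<close> is
    the action of these edges on \<open>x\<close>, and \<open>D u\<close> counts the walks of length
    two from \<open>v\<close> to \<open>u\<close>.\<close>
  define e where "e = m - deg v"
  define g where "g u = (\<Sum>w\<in>V'. a u w * x w)" for u
  define D where "D u = (\<Sum>w\<in>V'. a v w * a w u)" for u
  define Y where "Y = L2_set x V'"
  have split: "(\<Sum>w\<in>V. f w) = f v + (\<Sum>w\<in>V'. f w)" for f :: "'a \<Rightarrow> real"
    unfolding V'_def using finite_V v by (rule sum.remove)
  have dv': "deg v = (\<Sum>w\<in>V'. a v w)" unfolding deg_def split by (simp add: irrefl)
  have tot': "(\<Sum>u\<in>V'. \<Sum>w\<in>V'. a u w) = 2 * e"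
    using total_remove[OF v] by (simp add: V'_def e_def)
  have e0: "e \<ge> 0"
    using tot' sum_nonneg[of V' "\<lambda>u. \<Sum>w\<in>V'. a u w"] by (simp add: sum_nonneg a_nonneg)
  have lam4: "lam \<ge> 4"
  proof (rule power2_le_imp_le)
    show "4\<^sup>2 \<le> lam\<^sup>2" using lm m by simp
  qed (use lam in simp)
  have eq: "lam * x u = a u v + g u" if "u \<in> V'" for u
    using eig[of u] that xv unfolding split[of "\<lambda>w. a u w * x w"] g_def by (simp add: V'_def)
  \<comment> \<open>The degree assumption gives \<open>2 * e \<le> m / 100\<close>, and
    \<open>m\<close> is below \<open>lam\<^sup>2\<close>.\<close>
  have rho: "sqrt (2 * e) \<le> lam / 10"
    using dv lm lam by (intro real_le_lsqrt) (auto simp: e_def power_divide)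
  \<comment> \<open>Frobenius norm: the matrix restricted to \<open>V'\<close> has exactly
    \<open>2 * e\<close> ones.\<close>
  have g: "L2_set g V' \<le> sqrt (2 * e) * Y"
  proof -
    have "(g u)\<^sup>2 \<le> (\<Sum>w\<in>V'. a u w) * Y\<^sup>2" for u
      unfolding g_def Y_def L2_set_def using row_square_le[of u x V'] by (simp add: sum_nonneg)
    then have "(\<Sum>u\<in>V'. (g u)\<^sup>2) \<le> (\<Sum>u\<in>V'. (\<Sum>w\<in>V'. a u w) * Y\<^sup>2)" by (intro sum_mono)
    also have "\<dots> = 2 * e * Y\<^sup>2" by (simp flip: tot' sum_distrib_right)
    finally have "L2_set g V' \<le> sqrt (2 * e * Y\<^sup>2)" unfolding L2_set_def by simp
    then show ?thesis by (simp add: real_sqrt_mult Y_def)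
  qed
  have Y0: "0 \<le> Y" by (simp add: Y_def)
  \<comment> \<open>Away from \<open>v\<close> the eigenvalue equation bounds \<open>lam * Y\<close>
    by \<open>sqrt (deg v) \<le> lam\<close> plus at most a tenth of \<open>lam * Y\<close>, which
    is absorbed on the left.\<close>
  have Y: "Y \<le> 10 / 9"
  proof -
    have "lam * Y = L2_set (\<lambda>u. lam * x u) V'"
      unfolding Y_def using lam by (simp add: L2_set_right_distrib)
    also have "\<dots> = L2_set (\<lambda>u. a u v + g u) V'"
      by (intro L2_set_cong refl) (rule eq)
    also have "\<dots> \<le> L2_set (\<lambda>u. a u v) V' + L2_set g V'" by (rule L2_set_triangle_ineq)
    also have "L2_set (\<lambda>u. a u v) V' = sqrt (deg v)"
      unfolding L2_set_def dv' by (simp add: power2_eq_square a_square sym[of _ v])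
    also have "sqrt (deg v) \<le> lam"
      using e0 lm lam by (intro real_le_lsqrt) (auto simp: e_def)
    finally have "lam * Y \<le> lam + L2_set g V'" by simp
    also have "L2_set g V' \<le> lam / 10 * Y"
      using g mult_right_mono[OF rho Y0] by linarith
    finally have "lam * (9 / 10 * Y) \<le> lam * 1" by simp
    then have "9 / 10 * Y \<le> 1" using lam by (metis mult_le_cancel_left_pos)
    then show ?thesis by simp
  qed
  define P where "P = (\<Sum>u\<in>V'. D u * x u)"
  have D0: "D u \<ge> 0" for u
    unfolding D_def by (intro sum_nonneg mult_nonneg_nonneg a_nonneg)
  have sumD: "(\<Sum>u\<in>V'. D u) \<le> 2 * e"
  proof -
    have "(\<Sum>u\<in>V'. D u) \<le> (\<Sum>u\<in>V'. \<Sum>w\<in>V'. a w u)"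
      unfolding D_def by (intro sum_mono a_mult_le)
    also have "\<dots> = 2 * e" unfolding tot'[symmetric] by (rule sum.swap)
    finally show ?thesis .
  qed
  \<comment> \<open>Two steps of the eigenvalue equation from \<open>v\<close>: walks returning to
    \<open>v\<close> give \<open>deg v\<close>, all others give \<open>P\<close>. Since
    \<open>deg v = m - e\<close>, it remains to show \<open>P \<le> e\<close>.\<close>
  have lam2: "lam\<^sup>2 = deg v + P"
  proof -
    have "lam\<^sup>2 = lam * (lam * x v)" by (simp add: xv power2_eq_square)
    also have "lam * x v = (\<Sum>u\<in>V'. a v u * x u)"
      using eig[OF v] unfolding split by (simp add: irrefl)
    also have "lam * \<dots> = (\<Sum>u\<in>V'. a v u * (lam * x u))"
      by (simp add: sum_distrib_left mult_ac)
    also have "\<dots> = (\<Sum>u\<in>V'. a v u + a v u * g u)"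
      by (intro sum.cong refl) (metis eq a_square sym distrib_left)
    also have "\<dots> = deg v + (\<Sum>u\<in>V'. \<Sum>w\<in>V'. a v u * a u w * x w)"
      by (simp add: sum.distrib dv' g_def sum_distrib_left mult.assoc)
    also have "(\<Sum>u\<in>V'. \<Sum>w\<in>V'. a v u * a u w * x w) = P"
      unfolding P_def D_def sum_distrib_right by (rule sum.swap)
    finally show ?thesis .
  qed
  \<comment> \<open>A third step of the equation gains a factor \<open>lam\<close>: the steps into
    \<open>v\<close> cost at most \<open>2 * e\<close>, and the steps inside \<open>V'\<close> are
    controlled by the norm of \<open>g\<close>.\<close>
  have "lam * P = (\<Sum>u\<in>V'. D u * (lam * x u))"
    unfolding P_def by (simp add: sum_distrib_left mult_ac)
  also have "\<dots> = (\<Sum>u\<in>V'. D u * a u v) + (\<Sum>u\<in>V'. D u * g u)"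
    by (simp add: eq distrib_left sum.distrib)
  also have "(\<Sum>u\<in>V'. D u * a u v) \<le> (\<Sum>u\<in>V'. D u)"
    by (intro sum_mono mult_left_le a_le_1 D0)
  also note sumD
  also have "(\<Sum>u\<in>V'. D u * g u) \<le> (\<Sum>u\<in>V'. \<bar>D u\<bar> * \<bar>g u\<bar>)"
    by (intro sum_mono) (metis abs_ge_self abs_mult)
  also have "\<dots> \<le> L2_set D V' * L2_set g V'" by (rule L2_set_mult_ineq)
  also have "\<dots> \<le> (2 * e) * (lam / 9)"
  proof (rule mult_mono)
    show "L2_set D V' \<le> 2 * e" using L2_set_le_sum[of V' D] D0 sumD by simp
    have "L2_set g V' \<le> lam / 10 * (10 / 9)"
      using g mult_mono[OF rho Y] Y0 lam by simp
    then show "L2_set g V' \<le> lam / 9" by simp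
  qed (use e0 in auto)
  finally have "lam * P \<le> 2 * e + 2 * e * (lam / 9)" by simp
  \<comment> \<open>This amounts to \<open>18 \<le> 7 * lam\<close>, which
    \<open>lam \<ge> 4\<close> ensures.\<close>
  also have "\<dots> \<le> lam * e"
    using mult_left_mono[of 18 "lam * 7" e] lam4 e0 by (simp add: field_simps)
  finally have "P \<le> e" using lam by simp
  then show False using lam2 lm by (simp add: e_def)
qed

text \<open>Scaling to \<open>x v = 1\<close> gives the previous case. If \<open>x v = 0\<close>,
  then \<open>x\<close> is an eigenvector of what remains after deleting \<open>v\<close>; with at
  most \<open>m / 200\<close> edges left, the Frobenius bound puts \<open>lam\<^sup>2\<close> far
  below \<open>m\<close>.\<close>

lemma star_bound:
  assumes v: "v \<in> V" and eig: "\<And>u. u \<in> V \<Longrightarrow> (\<Sum>w\<in>V. a u w * x w) = lam * x u"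
    and nz: "\<exists>u\<in>V. x u \<noteq> 0"
    and lam: "lam > 0" and m: "m \<ge> 16" and dv: "deg v \<ge> 199 / 200 * m"
  shows "lam\<^sup>2 \<le> m"
proof (cases "x v = 0")
  case False
  show ?thesis
  proof (rule star_bound_normalised[OF v _ _ lam m dv])
    show "(\<Sum>w\<in>V. a u w * (x w / x v)) = lam * (x u / x v)" if "u \<in> V" for u
      using eig[OF that] by (simp flip: sum_divide_distrib)
  qed (use False in simp)
next
  case True
  define V' where "V' = V - {v}"
  have split: "(\<Sum>w\<in>V. f w) = f v + (\<Sum>w\<in>V'. f w)" for f :: "'a \<Rightarrow> real"
    unfolding V'_def using finite_V v by (rule sum.remove)
  define X where "X = (\<Sum>u\<in>V'. (x u)\<^sup>2)"
  have X: "X > 0"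
  proof -
    obtain u where "u \<in> V'" "x u \<noteq> 0" using nz True by (auto simp: V'_def)
    then show ?thesis unfolding X_def using finite_V by (intro sum_pos2[of _ u]) (auto simp: V'_def)
  qed
  have "(lam * x u)\<^sup>2 \<le> (\<Sum>w\<in>V'. a u w) * X" if "u \<in> V'" for u
  proof -
    have "lam * x u = (\<Sum>w\<in>V'. a u w * x w)"
      using eig[of u] that True unfolding split[of "\<lambda>w. a u w * x w"] by (simp add: V'_def)
    then show ?thesis unfolding X_def using row_square_le[of u x V'] by simp
  qed
  then have "(\<Sum>u\<in>V'. (lam * x u)\<^sup>2) \<le> (\<Sum>u\<in>V'. (\<Sum>w\<in>V'. a u w) * X)" by (intro sum_mono)
  then have "lam\<^sup>2 * X \<le> (\<Sum>u\<in>V'. \<Sum>w\<in>V'. a u w) * X"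
    unfolding X_def by (simp add: power_mult_distrib flip: sum_distrib_left sum_distrib_right)
  then have "lam\<^sup>2 \<le> (\<Sum>u\<in>V'. \<Sum>w\<in>V'. a u w)" using X by simp
  also have "\<dots> = 2 * (m - deg v)" unfolding V'_def by (rule total_remove[OF v])
  finally show ?thesis using dv m by simp
qed

subsection \<open>Spread and concentrated eigenvectors\<close>


text \<open>\<open>lam\<^sup>2\<close> is the squared norm of the image of \<open>x\<close>. Small
  coordinates make the vertices of large degree negligible in it, and the rest expands into
  codegrees weighted by \<open>x u * x v\<close>, to be compared with their squares.\<close>

lemma spread_eigenvector_bound:
  assumes eig: "\<And>u. u \<in> V \<Longrightarrow> (\<Sum>w\<in>V. a u w * x w) = lam * x u"
    and unit: "(\<Sum>u\<in>V. (x u)\<^sup>2) = 1"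
    and small: "\<And>u. u \<in> V \<Longrightarrow> (x u)\<^sup>2 \<le> s\<^sup>2"
    and s: "0 < s" "s \<le> 1 / 2" and m: "0 < m" and lam: "m \<le> lam\<^sup>2"
  obtains S where "S \<subseteq> V"
    "(1 - 10 * s) * m\<^sup>2 \<le> (\<Sum>u\<in>V. \<Sum>v\<in>V - {u}. (cdeg S u v)\<^sup>2 - cdeg S u v)"
proof
  \<comment> \<open>The threshold serves twice: at most \<open>2 / s\<close> vertices are left out,
    and walks of length two with middle in \<open>S\<close> number at most
    \<open>2 * s * m\<^sup>2\<close>.\<close>
  define S where "S = {w \<in> V. deg w < s * m}"
  show SV: "S \<subseteq> V" by (auto simp: S_def)
  define z where "z w = (\<Sum>u\<in>V. a w u * x u)" for w
  define C where "C = (\<Sum>u\<in>V. \<Sum>v\<in>V - {u}. cdeg S u v)"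
  define Q where "Q = (\<Sum>u\<in>V. \<Sum>v\<in>V - {u}. (cdeg S u v)\<^sup>2)"
  define M where "M = (\<Sum>u\<in>V. \<Sum>v\<in>V - {u}. cdeg S u v * (x u * x v))"
  have removeV: "(\<Sum>w\<in>V. f w) = f u + (\<Sum>w\<in>V - {u}. f w)" if "u \<in> V" for u and f :: "'a \<Rightarrow> real"
    using finite_V that by (rule sum.remove)

  have cardW: "s * real (card (V - S)) \<le> 2"
  proof -
    have "real (card (V - S)) * (s * m) = (\<Sum>w\<in>V - S. s * m)" by simp
    also have "\<dots> \<le> (\<Sum>w\<in>V - S. deg w)" by (intro sum_mono) (auto simp: S_def)
    also have "\<dots> \<le> (\<Sum>w\<in>V. deg w)" using finite_V by (intro sum_mono2) (auto simp: deg_nonneg)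
    finally have "m * (s * real (card (V - S))) \<le> m * 2" by (simp add: sum_deg mult_ac)
    then show ?thesis using m by simp
  qed
  \<comment> \<open>Each discarded vertex contributes at most
    \<open>lam\<^sup>2 * s\<^sup>2\<close>, and there are at most \<open>2 / s\<close> of
    them.\<close>
  have large: "(\<Sum>w\<in>V - S. (z w)\<^sup>2) \<le> lam\<^sup>2 * (2 * s)"
  proof -
    have "(\<Sum>w\<in>V - S. (z w)\<^sup>2) \<le> (\<Sum>w\<in>V - S. lam\<^sup>2 * s\<^sup>2)"
      using small by (intro sum_mono) (auto simp: z_def eig power_mult_distrib intro: mult_left_mono)
    also have "\<dots> = lam\<^sup>2 * s * (s * real (card (V - S)))" by (simp add: power2_eq_square)
    also have "\<dots> \<le> lam\<^sup>2 * s * 2" using cardW s by (intro mult_left_mono) auto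
    finally show ?thesis by simp
  qed
  have "(\<Sum>w\<in>V. (z w)\<^sup>2) = lam\<^sup>2"
    by (simp add: z_def eig power_mult_distrib unit flip: sum_distrib_left)
  then have "lam\<^sup>2 = (\<Sum>w\<in>V - S. (z w)\<^sup>2) + (\<Sum>w\<in>S. (z w)\<^sup>2)"
    using sum.subset_diff[OF SV finite_V, of "\<lambda>w. (z w)\<^sup>2"] by simp
  then have "lam\<^sup>2 * (1 - 2 * s) \<le> (\<Sum>w\<in>S. (z w)\<^sup>2)" using large by (simp add: algebra_simps)
  moreover have "m * (1 - 2 * s) \<le> lam\<^sup>2 * (1 - 2 * s)" using lam s by (intro mult_right_mono) auto
  ultimately have low: "m * (1 - 2 * s) \<le> (\<Sum>w\<in>S. (z w)\<^sup>2)" by linarith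
  have "(\<Sum>w\<in>S. (z w)\<^sup>2) = (\<Sum>w\<in>S. \<Sum>u\<in>V. \<Sum>v\<in>V. (a u w * a w v) * (x u * x v))"
    unfolding z_def power2_eq_square sum_product
    by (intro sum.cong refl) (simp add: sym mult_ac)
  also have "\<dots> = (\<Sum>u\<in>V. \<Sum>v\<in>V. cdeg S u v * (x u * x v))"
    unfolding cdeg_def sum_distrib_right
    by (subst sum.swap) (intro sum.cong refl sum.swap)
  also have "\<dots> = (\<Sum>u\<in>V. cdeg S u u * (x u)\<^sup>2) + M"
    unfolding M_def sum.distrib[symmetric]
    by (intro sum.cong refl) (simp add: removeV power2_eq_square)
  \<comment> \<open>The diagonal terms do not come from 4-cycles; smallness of the coordinates makes
    them cost only \<open>2 * s\<^sup>2 * m\<close>.\<close>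
  also have "(\<Sum>u\<in>V. cdeg S u u * (x u)\<^sup>2) \<le> (\<Sum>u\<in>V. deg u * s\<^sup>2)"
    by (intro sum_mono mult_mono cdeg_le_deg SV small deg_nonneg) auto
  also have "\<dots> = m * (2 * s\<^sup>2)" by (simp add: sum_deg flip: sum_distrib_right)
  finally have "m * (1 - 2 * s) \<le> m * (2 * s\<^sup>2) + M" using low by simp
  moreover have "m * (2 * s\<^sup>2) \<le> m * (2 * s)"
    using m s by (intro mult_left_mono) (auto simp: power2_eq_square mult_left_le)
  ultimately have Mlow: "m * (1 - 4 * s) \<le> M" by (simp add: algebra_simps)

  \<comment> \<open>\<open>2 * c * d \<le> c\<^sup>2 + d\<^sup>2\<close> with
    \<open>d = m * (x u * x v)\<close>; since \<open>x\<close> is a unit vector, the squares of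
    these \<open>d\<close> sum to at most \<open>m\<^sup>2\<close>.\<close>
  have Mup: "2 * m * M \<le> Q + m\<^sup>2"
  proof -
    have "2 * m * M = (\<Sum>u\<in>V. \<Sum>v\<in>V - {u}. 2 * cdeg S u v * (m * (x u * x v)))"
      unfolding M_def sum_distrib_left by (intro sum.cong refl) (simp add: mult_ac)
    also have "\<dots> \<le> (\<Sum>u\<in>V. \<Sum>v\<in>V - {u}. (cdeg S u v)\<^sup>2 + (m * (x u * x v))\<^sup>2)"
      by (intro sum_mono sum_squares_bound)
    also have "\<dots> = Q + (\<Sum>u\<in>V. \<Sum>v\<in>V - {u}. (m * (x u * x v))\<^sup>2)"
      by (simp add: Q_def sum.distrib)
    also have "(\<Sum>u\<in>V. \<Sum>v\<in>V - {u}. (m * (x u * x v))\<^sup>2) \<le> (\<Sum>u\<in>V. \<Sum>v\<in>V. (m * (x u * x v))\<^sup>2)"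
      using finite_V by (intro sum_mono sum_mono2) auto
    also have "\<dots> = m\<^sup>2 * ((\<Sum>u\<in>V. (x u)\<^sup>2) * (\<Sum>u\<in>V. (x u)\<^sup>2))"
      unfolding sum_product by (simp add: power_mult_distrib sum_distrib_left)
    finally show ?thesis by (simp add: unit)
  qed
  have Cup: "C \<le> 2 * s * m\<^sup>2"
  proof -
    have "C \<le> (\<Sum>u\<in>V. \<Sum>v\<in>V. cdeg S u v)"
      unfolding C_def using finite_V by (intro sum_mono sum_mono2) (auto simp: cdeg_nonneg)
    also have "\<dots> = (\<Sum>w\<in>S. \<Sum>u\<in>V. \<Sum>v\<in>V. a u w * a w v)"
      unfolding cdeg_def by (subst (2) sum.swap) (intro sum.cong refl sum.swap)
    also have "\<dots> = (\<Sum>w\<in>S. deg w * deg w)"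
      unfolding deg_def sum_product by (intro sum.cong refl) (simp add: sym)
    also have "\<dots> \<le> (\<Sum>w\<in>S. s * m * deg w)"
      by (intro sum_mono mult_right_mono deg_nonneg) (auto simp: S_def)
    also have "\<dots> \<le> (\<Sum>w\<in>V. s * m * deg w)"
      using finite_V SV s m by (intro sum_mono2) (auto simp: deg_nonneg)
    also have "\<dots> = 2 * s * m\<^sup>2"
      by (simp add: sum_deg power2_eq_square flip: sum_distrib_left)
    finally show ?thesis .
  qed
  \<comment> \<open>Thus \<open>Q\<close> is at least \<open>(1 - 8 * s) * m\<^sup>2\<close>, and
    subtracting \<open>C\<close> loses another \<open>2 * s * m\<^sup>2\<close>.\<close>
  have "2 * m * (m * (1 - 4 * s)) \<le> 2 * m * M"
    using Mlow m by (intro mult_left_mono) auto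
  then have "(1 - 10 * s) * m\<^sup>2 \<le> Q - C"
    using Mup Cup by (simp add: power2_eq_square algebra_simps)
  also have "Q - C = (\<Sum>u\<in>V. \<Sum>v\<in>V - {u}. (cdeg S u v)\<^sup>2 - cdeg S u v)"
    by (simp add: Q_def C_def sum_subtractf)
  finally show "(1 - 10 * s) * m\<^sup>2 \<le> (\<Sum>u\<in>V. \<Sum>v\<in>V - {u}. (cdeg S u v)\<^sup>2 - cdeg S u v)" .
qed

section \<open>Eigenvectors with a dominant coordinate\<close>

lemma sum_deg_subset_le:
  assumes K: "K \<subseteq> V"
  shows "(\<Sum>t\<in>K. deg t) \<le> m + (real (card K))\<^sup>2"
proof -
  have fin: "finite K" using finite_V K by (rule rev_finite_subset)
  have split: "(\<Sum>w\<in>V. f w) = (\<Sum>w\<in>V - K. f w) + (\<Sum>w\<in>K. f w)" for f :: "'a \<Rightarrow> real"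
    using sum.subset_diff[OF K finite_V] .
  define A B C where "A = (\<Sum>t\<in>K. \<Sum>w\<in>K. a t w)" and "B = (\<Sum>t\<in>K. \<Sum>w\<in>V - K. a t w)"
    and "C = (\<Sum>t\<in>V - K. \<Sum>w\<in>V - K. a t w)"
  have B: "(\<Sum>t\<in>V - K. \<Sum>w\<in>K. a t w) = B"
    unfolding B_def by (subst sum.swap) (simp add: sym)
  have deg: "(\<Sum>t\<in>K. deg t) = B + A"
    unfolding deg_def split[of "a _"] sum.distrib A_def B_def ..
  have "(\<Sum>t\<in>V - K. deg t) = C + B"
    unfolding deg_def split[of "a _"] sum.distrib B C_def ..
  \<comment> \<open>Only edges inside \<open>K\<close> count twice in its degree sum, so the excess
    over \<open>m\<close> is at most \<open>A / 2\<close>.\<close>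
  then have "2 * m = C + B + (B + A)" using sum_deg split[of deg] deg by simp
  moreover have "A \<le> (\<Sum>t\<in>K. \<Sum>w\<in>K. 1)" unfolding A_def by (intro sum_mono a_le_1)
  moreover have "C \<ge> 0" "A \<ge> 0" unfolding C_def A_def by (intro sum_nonneg a_nonneg)+
  ultimately show ?thesis unfolding deg by (simp add: power2_eq_square)
qed

text \<open>The set \<open>T\<close> consists of the near-maximal coordinates of \<open>y\<close>. The last two conclusions say that
  almost all edges join \<open>T\<close> to the neighbourhood of each of its members.\<close>

lemma concentrated_structure:
  assumes v: "v \<in> V" and yv: "y v = 1" and y1: "\<And>u. u \<in> V \<Longrightarrow> y u \<le> 1"
    and y0: "\<And>u. u \<in> V \<Longrightarrow> 0 \<le> y u"
    and sub: "\<And>u. u \<in> V \<Longrightarrow> lam * y u \<le> (\<Sum>w\<in>V. a u w * y w)"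
    and yL: "(\<Sum>u\<in>V. (y u)\<^sup>2) \<le> L" and lam: "0 < lam" "m \<le> lam\<^sup>2"
    and \<tau>: "0 < \<tau>" "\<tau> \<le> 1 / 2" and m: "4 * (64 * L / \<tau> ^ 4)\<^sup>2 \<le> \<tau>\<^sup>2 * m"
  obtains T where "T \<subseteq> V" "v \<in> T" "4 * (real (card T))\<^sup>2 \<le> \<tau>\<^sup>2 * m"
    "(\<Sum>t\<in>T. deg t) \<le> m + \<tau>\<^sup>2 * m / 4"
    "\<And>u. u \<in> T \<Longrightarrow> (1 - 2 * \<tau>) * m \<le> (\<Sum>t\<in>T. cdeg V u t)"
proof -
  \<comment> \<open>Coordinates below \<open>\<delta>\<close> contribute at most
    \<open>\<delta> * (2 * m)\<close>, that is \<open>\<tau>\<^sup>2 * m / 4\<close>, to a two-step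
    sum. \<open>K\<close> collects the remaining ones, \<open>T\<close> those close to the maximum
    1.\<close>
  define \<delta> where "\<delta> = \<tau>\<^sup>2 / 8"
  have \<delta>: "0 < \<delta>" "\<delta> \<le> 1 - \<tau>"
    using \<tau> power_mono[of \<tau> "1/2" 2] by (auto simp: \<delta>_def power2_eq_square)
  define K where "K = {t \<in> V. \<delta> \<le> y t}"
  define T where "T = {t \<in> V. 1 - \<tau> \<le> y t}"
  have KV: "K \<subseteq> V" and TK: "T \<subseteq> K" using \<delta> by (auto simp: K_def T_def)
  have finK: "finite K" using finite_V KV by (rule rev_finite_subset)
  \<comment> \<open>At most \<open>L / \<delta>\<^sup>2\<close> coordinates reach
    \<open>\<delta>\<close>; this is the origin of \<open>64 * L / \<tau> ^ 4\<close> in the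
    assumption on \<open>m\<close>.\<close>
  have "real (card K) * \<delta>\<^sup>2 = (\<Sum>t\<in>K. \<delta>\<^sup>2)" by simp
  also have "\<dots> \<le> (\<Sum>t\<in>K. (y t)\<^sup>2)"
    using \<delta> by (intro sum_mono power_mono) (auto simp: K_def)
  also have "\<dots> \<le> (\<Sum>t\<in>V. (y t)\<^sup>2)" using finite_V KV by (intro sum_mono2) auto
  also note yL
  finally have "real (card K) \<le> 64 * L / \<tau> ^ 4"
    using \<tau> by (simp add: \<delta>_def field_simps)
  then have "(real (card K))\<^sup>2 \<le> (64 * L / \<tau> ^ 4)\<^sup>2" by (intro power_mono) auto
  then have cK: "4 * (real (card K))\<^sup>2 \<le> \<tau>\<^sup>2 * m" using m by linarith
  have "real (card T) \<le> real (card K)" using TK finK by (simp add: card_mono)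
  then have "(real (card T))\<^sup>2 \<le> (real (card K))\<^sup>2" by (intro power_mono) auto
  then have cT: "4 * (real (card T))\<^sup>2 \<le> \<tau>\<^sup>2 * m" using cK by linarith
  have sK: "(\<Sum>t\<in>K. deg t) \<le> m + \<tau>\<^sup>2 * m / 4" using sum_deg_subset_le[OF KV] cK by linarith
  have sT: "(\<Sum>t\<in>T. deg t) \<le> (\<Sum>t\<in>K. deg t)"
    using finK TK by (intro sum_mono2) (auto simp: deg_nonneg)
  \<comment> \<open>\<open>sub\<close> is applied twice; nonnegativity of \<open>lam\<close> and
    \<open>a\<close> preserves the inequality.\<close>
  have two_step: "lam\<^sup>2 * y u \<le> (\<Sum>t\<in>K. y t * cdeg V u t) + \<tau>\<^sup>2 * m / 4" if u: "u \<in> V" for u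
  proof -
    have "lam\<^sup>2 * y u = lam * (lam * y u)" by (simp add: power2_eq_square)
    also have "\<dots> \<le> lam * (\<Sum>w\<in>V. a u w * y w)" using sub[OF u] lam by (intro mult_left_mono) auto
    also have "\<dots> = (\<Sum>w\<in>V. a u w * (lam * y w))" by (simp add: sum_distrib_left mult_ac)
    also have "\<dots> \<le> (\<Sum>w\<in>V. a u w * (\<Sum>t\<in>V. a w t * y t))"
      by (intro sum_mono mult_left_mono sub a_nonneg)
    also have "\<dots> = (\<Sum>t\<in>V. y t * cdeg V u t)"
      unfolding cdeg_def sum_distrib_left by (subst sum.swap) (simp add: mult_ac)
    also have "\<dots> = (\<Sum>t\<in>V - K. y t * cdeg V u t) + (\<Sum>t\<in>K. y t * cdeg V u t)"
      by (rule sum.subset_diff[OF KV finite_V])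
    also have "(\<Sum>t\<in>V - K. y t * cdeg V u t) \<le> (\<Sum>t\<in>V - K. \<delta> * deg t)"
      using \<delta> by (intro sum_mono mult_mono cdeg_le_deg cdeg_nonneg) (auto simp: K_def)
    also have "\<dots> \<le> (\<Sum>t\<in>V. \<delta> * deg t)"
      using \<delta> finite_V by (intro sum_mono2) (auto simp: deg_nonneg)
    also have "\<dots> = \<delta> * (2 * m)" unfolding sum_distrib_left[symmetric] sum_deg ..
    also have "\<dots> = \<tau>\<^sup>2 * m / 4" by (simp add: \<delta>_def)
    finally show ?thesis by simp
  qed
  have gap: "0 \<le> deg t - y t * cdeg V v t" if "t \<in> V" for t
    using mult_mono[OF y1[OF that] cdeg_le_deg[OF order.refl, of v t]] y0[OF that]
      cdeg_nonneg[of V v t] by simp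
  \<comment> \<open>At \<open>v\<close> the two-step sum over \<open>K\<close> nearly exhausts the
    degree sum over \<open>K\<close>: the total deficit is at most
    \<open>\<tau>\<^sup>2 * m / 2\<close>. Every \<open>t\<close> outside \<open>T\<close> has a
    deficit of at least \<open>\<tau> * deg t\<close>.\<close>
  have "\<tau> * (\<Sum>t\<in>K - T. deg t) = (\<Sum>t\<in>K - T. \<tau> * deg t)" by (rule sum_distrib_left)
  also have "\<dots> \<le> (\<Sum>t\<in>K - T. deg t - y t * cdeg V v t)"
  proof (intro sum_mono)
    fix t assume t: "t \<in> K - T"
    then have "y t * cdeg V v t \<le> (1 - \<tau>) * deg t"
      using \<tau> by (intro mult_mono cdeg_le_deg cdeg_nonneg) (auto simp: K_def T_def)
    then show "\<tau> * deg t \<le> deg t - y t * cdeg V v t" by (simp add: algebra_simps)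
  qed
  also have "\<dots> \<le> (\<Sum>t\<in>K. deg t - y t * cdeg V v t)"
    using finK KV gap by (intro sum_mono2) auto
  also have "\<dots> \<le> \<tau> * (\<tau> * m / 2)"
    using two_step[OF v] sK lam(2) by (simp add: sum_subtractf yv power2_eq_square)
  finally have sKT: "(\<Sum>t\<in>K - T. deg t) \<le> \<tau> * m / 2" using \<tau> by simp
  \<comment> \<open>The losses are \<open>\<tau> * m\<close> from \<open>y u\<close>,
    \<open>\<tau> * m / 2\<close> from \<open>K - T\<close> and
    \<open>\<tau>\<^sup>2 * m / 4\<close> from outside \<open>K\<close>, together at most
    \<open>2 * \<tau> * m\<close>.\<close>
  have "(1 - 2 * \<tau>) * m \<le> (\<Sum>t\<in>T. cdeg V u t)" if u: "u \<in> T" for u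
  proof -
    have uV: "u \<in> V" "1 - \<tau> \<le> y u" using u by (auto simp: T_def)
    have "(1 - \<tau>) * m \<le> y u * lam\<^sup>2"
      using uV lam \<tau> m_nonneg by (intro mult_mono) auto
    also have "\<dots> \<le> (\<Sum>t\<in>K. y t * cdeg V u t) + \<tau>\<^sup>2 * m / 4"
      using two_step[OF uV(1)] by (simp add: mult.commute)
    also have "(\<Sum>t\<in>K. y t * cdeg V u t) = (\<Sum>t\<in>K - T. y t * cdeg V u t) + (\<Sum>t\<in>T. y t * cdeg V u t)"
      by (rule sum.subset_diff[OF TK finK])
    also have "(\<Sum>t\<in>K - T. y t * cdeg V u t) \<le> (\<Sum>t\<in>K - T. 1 * deg t)"
      using KV y1 by (intro sum_mono mult_mono cdeg_le_deg cdeg_nonneg) auto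
    also have "(\<Sum>t\<in>T. y t * cdeg V u t) \<le> (\<Sum>t\<in>T. cdeg V u t)"
      using y1 y0 by (intro sum_mono mult_left_le_one_le cdeg_nonneg) (auto simp: T_def)
    finally have "(1 - \<tau>) * m \<le> \<tau> * m / 2 + (\<Sum>t\<in>T. cdeg V u t) + \<tau>\<^sup>2 * m / 4"
      using sKT by simp
    moreover have "\<tau>\<^sup>2 * m \<le> \<tau> * m"
      using \<tau> m_nonneg by (intro mult_right_mono) (auto simp: power2_eq_square mult_left_le)
    moreover have "0 \<le> \<tau> * m" using \<tau> m_nonneg by simp
    ultimately show ?thesis by (simp add: algebra_simps)
  qed
  moreover have "T \<subseteq> V" "v \<in> T" using v yv \<tau> by (auto simp: T_def)
  ultimately show thesis using that cT sT sK by (meson order.trans)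
qed

text \<open>With \<open>k = card T\<close>, the codegrees over the \<open>k * (k - 1)\<close>
  ordered pairs in \<open>T\<close> sum to about \<open>(k - 1) * m\<close>. By convexity their
  squares sum to about \<open>(k - 1) / k * m\<^sup>2\<close> or more, and
  \<open>(k - 1) / k\<close> is least, namely 1/2, at \<open>k = 2\<close>.\<close>

lemma large_codegrees_bound:
  assumes TV: "T \<subseteq> V" and T2: "2 \<le> card T" and cT: "4 * (real (card T))\<^sup>2 \<le> \<tau>\<^sup>2 * m"
    and sT: "(\<Sum>t\<in>T. deg t) \<le> m + \<tau>\<^sup>2 * m / 4"
    and cod: "\<And>u. u \<in> T \<Longrightarrow> (1 - 2 * \<tau>) * m \<le> (\<Sum>t\<in>T. cdeg V u t)"
    and \<tau>: "0 < \<tau>" "\<tau> \<le> 1 / 12"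
  shows "(1 - 14 * \<tau>) / 2 * m\<^sup>2 \<le> (\<Sum>u\<in>T. \<Sum>t\<in>T - {u}. (cdeg (V - T) u t)\<^sup>2 - cdeg (V - T) u t)"
proof -
  have fin: "finite T" using finite_V TV by (rule rev_finite_subset)
  define k where "k = real (card T)"
  have k: "2 \<le> k" using T2 by (simp add: k_def)
  have tm: "\<tau>\<^sup>2 * m \<le> \<tau> * m"
    using \<tau> m_nonneg by (intro mult_right_mono) (auto simp: power2_eq_square mult_left_le)
  have kk: "k\<^sup>2 \<le> \<tau> * m" using cT tm zero_le_power2[of k] unfolding k_def[symmetric] by linarith
  have km: "k \<le> \<tau> * m" using kk k self_le_power[of k 2] by simp
  have cardm: "real (card (T - {u})) = k - 1" if "u \<in> T" for u
    using that T2 by (simp add: k_def card_Diff_singleton of_nat_diff)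
  define \<Sigma> where "\<Sigma> = (\<Sum>u\<in>T. \<Sum>t\<in>T - {u}. cdeg (V - T) u t)"
  \<comment> \<open>Moving the common neighbours out of \<open>T\<close> loses at most
    \<open>k\<close> per pair and makes the two diagonals of a cycle lie in disjoint sets.\<close>
  have c': "cdeg V u t - k \<le> cdeg (V - T) u t" for u t
  proof -
    have "cdeg V u t = cdeg (V - T) u t + cdeg T u t"
      unfolding cdeg_def by (rule sum.subset_diff[OF TV finite_V])
    moreover have "cdeg T u t \<le> (\<Sum>w\<in>T. 1)"
      unfolding cdeg_def by (intro sum_mono) (metis a_mult_le(1) a_le_1 order.trans)
    ultimately show ?thesis by (simp add: k_def)
  qed
  \<comment> \<open>The diagonal term of the row sum is \<open>deg u\<close>; these terms sum to
    little more than \<open>m\<close>, which turns \<open>k * m\<close> into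
    \<open>(k - 1) * m\<close>.\<close>
  have row: "(1 - 2 * \<tau>) * m - deg u - k * (k - 1) \<le> (\<Sum>t\<in>T - {u}. cdeg (V - T) u t)" if u: "u \<in> T" for u
  proof -
    have "(1 - 2 * \<tau>) * m \<le> deg u + (\<Sum>t\<in>T - {u}. cdeg V u t)"
      using cod[OF u] sum.remove[OF fin u, of "cdeg V u"] by (simp add: cdeg_self)
    moreover have "(\<Sum>t\<in>T - {u}. cdeg V u t - k) \<le> (\<Sum>t\<in>T - {u}. cdeg (V - T) u t)"
      by (intro sum_mono c')
    ultimately show ?thesis using cardm[OF u] by (simp add: sum_subtractf mult.commute)
  qed
  have "k * ((1 - 2 * \<tau>) * m) - (\<Sum>u\<in>T. deg u) - k * (k * (k - 1)) =
      (\<Sum>u\<in>T. (1 - 2 * \<tau>) * m - deg u - k * (k - 1))"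
    by (simp add: sum_subtractf k_def)
  also have "\<dots> \<le> \<Sigma>" unfolding \<Sigma>_def by (intro sum_mono row)
  finally have "k * ((1 - 2 * \<tau>) * m) - (\<Sum>u\<in>T. deg u) - k\<^sup>2 * (k - 1) \<le> \<Sigma>"
    by (simp add: power2_eq_square mult.assoc)
  moreover have "0 \<le> \<tau> * m" using \<tau> m_nonneg by simp
  ultimately have S1: "k * ((1 - 2 * \<tau>) * m) - m - \<tau> * m - k\<^sup>2 * (k - 1) \<le> \<Sigma>"
    using sT tm by linarith
  \<comment> \<open>As \<open>k \<ge> 2\<close>, the errors \<open>2 * \<tau> * m * k\<close>,
    \<open>\<tau> * m\<close> and \<open>k\<^sup>2 * (k - 1)\<close> are at most 4, 1 and 1 times
    \<open>\<tau> * m * (k - 1)\<close>, hence the 6.\<close>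
  define \<mu> where "\<mu> = (1 - 6 * \<tau>) * m"
  have S2: "(k - 1) * \<mu> \<le> \<Sigma>"
  proof -
    have "k\<^sup>2 * (k - 1) \<le> \<tau> * m * (k - 1)" using kk k by (intro mult_right_mono) auto
    moreover have "\<tau> * m * 1 \<le> \<tau> * m * (k - 1)"
      using k \<tau> m_nonneg by (intro mult_left_mono) auto
    moreover have "\<tau> * m * k \<le> \<tau> * m * (2 * (k - 1))"
      using k \<tau> m_nonneg by (intro mult_left_mono) auto
    ultimately show ?thesis using S1 by (simp add: \<mu>_def algebra_simps)
  qed
  \<comment> \<open>The guaranteed average codegree. Convexity enters through the tangent to the
    square at \<open>\<alpha>\<close>; \<open>\<alpha> \<ge> 1\<close> keeps its slope minus 1
    positive, so that the lower bound for \<open>\<Sigma>\<close> may be inserted.\<close>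
  define \<alpha> where "\<alpha> = \<mu> / k"
  have ak: "\<mu> = k * \<alpha>" using k by (simp add: \<alpha>_def)
  have mu: "m / 2 \<le> \<mu>" "\<mu> \<le> m"
    using \<tau> m_nonneg mult_right_mono[of "1/2" "1 - 6 * \<tau>" m] mult_right_mono[of "1 - 6 * \<tau>" 1 m]
    by (auto simp: \<mu>_def)
  have "\<tau> * m \<le> m / 2" using \<tau> m_nonneg mult_right_mono[of \<tau> "1/2" m] by simp
  then have al: "1 \<le> \<alpha>" using k km mu by (simp add: \<alpha>_def)
  have "(2 * \<alpha> - 1) * c - \<alpha>\<^sup>2 \<le> c\<^sup>2 - c" for c :: real
    using zero_le_power2[of "c - \<alpha>"] by (simp add: power2_eq_square algebra_simps)
  then have "(\<Sum>u\<in>T. \<Sum>t\<in>T - {u}. (2 * \<alpha> - 1) * cdeg (V - T) u t - \<alpha>\<^sup>2) \<le>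
      (\<Sum>u\<in>T. \<Sum>t\<in>T - {u}. (cdeg (V - T) u t)\<^sup>2 - cdeg (V - T) u t)" (is "_ \<le> ?R")
    by (intro sum_mono)
  also have "(\<Sum>u\<in>T. \<Sum>t\<in>T - {u}. (2 * \<alpha> - 1) * cdeg (V - T) u t - \<alpha>\<^sup>2) =
      (2 * \<alpha> - 1) * \<Sigma> - k * ((k - 1) * \<alpha>\<^sup>2)"
    unfolding sum_subtractf \<Sigma>_def sum_distrib_left using T2 by (simp add: cardm k_def of_nat_diff)
  finally have R: "(2 * \<alpha> - 1) * \<Sigma> - k * ((k - 1) * \<alpha>\<^sup>2) \<le> ?R" .
  have "(2 * \<alpha> - 1) * ((k - 1) * \<mu>) \<le> (2 * \<alpha> - 1) * \<Sigma>"
    using S2 al by (intro mult_left_mono) auto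
  then have R2: "(k - 1) * (\<alpha> * \<mu> - \<mu>) \<le> ?R"
    using R by (simp add: ak power2_eq_square algebra_simps)
  have "\<mu>\<^sup>2 / 2 - k * \<mu> \<le> (k - 1) * (\<alpha> * \<mu> - \<mu>)"
  proof -
    have "\<mu>\<^sup>2 / 2 \<le> (k - 1) * (\<alpha> * \<mu>)"
      using k mult_right_mono[of "k" "2 * (k - 1)" "\<alpha> * \<mu>"] al mu m_nonneg
      by (simp add: power2_eq_square ak)
    moreover have "(k - 1) * \<mu> \<le> k * \<mu>" using mu m_nonneg by (intro mult_right_mono) auto
    ultimately show ?thesis by (simp add: algebra_simps)
  qed
  moreover have "k * \<mu> \<le> \<tau> * m * m" using km mu m_nonneg k by (intro mult_mono) auto
  moreover have "(1 - 12 * \<tau>) * m\<^sup>2 \<le> \<mu>\<^sup>2"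
    unfolding \<mu>_def power_mult_distrib
    by (intro mult_right_mono) (auto simp: power2_eq_square algebra_simps)
  moreover have "(1 - 14 * \<tau>) / 2 * m\<^sup>2 = (1 - 12 * \<tau>) * m\<^sup>2 / 2 - \<tau> * m * m"
    by (simp add: power2_eq_square field_simps)
  ultimately have "(1 - 14 * \<tau>) / 2 * m\<^sup>2 \<le> (k - 1) * (\<alpha> * \<mu> - \<mu>)"
    by linarith
  then show ?thesis using R2 by linarith
qed

end

subsection \<open>The lower bound\<close>

lemma sum_adj:
  assumes G: "simple_graph G"
  shows "(\<Sum>u\<in>verts G. \<Sum>v\<in>verts G. adj G u v) = 2 * real (card (edges G))"
proof -
  have finV: "finite (verts G)" using G by (simp add: simple_graph_def)
  have "edges G \<subseteq> Pow (verts G)" using G by (auto simp: simple_graph_def)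
  then have finE: "finite (edges G)" using finV by (meson finite_Pow_iff finite_subset)
  have one: "(\<Sum>u\<in>verts G. \<Sum>v\<in>verts G. of_bool (e = {u, v})) = (2 :: real)" if "e \<in> edges G" for e
  proof -
    have "card e = 2" "e \<subseteq> verts G" using G that by (auto simp: simple_graph_def)
    then obtain p q where e: "e = {p, q}" "p \<noteq> q" "p \<in> verts G" "q \<in> verts G"
      by (auto simp: card_2_iff)
    have "of_bool (e = {u, v}) =
        (if u = p then of_bool (v = q) else 0) + (if u = q then of_bool (v = p) else (0 :: real))" for u v
      using e(2) by (auto simp: e(1) doubleton_eq_iff)
    then have "(\<Sum>u\<in>verts G. \<Sum>v\<in>verts G. of_bool (e = {u, v})) =
        (\<Sum>u\<in>verts G. (if u = p then 1 else 0) + (if u = q then 1 else (0 :: real)))"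
      using e finV by (intro sum.cong refl) (simp add: sum.distrib of_bool_def)
    then show ?thesis using e finV by (simp add: sum.distrib)
  qed
  have "(\<Sum>u\<in>verts G. \<Sum>v\<in>verts G. adj G u v) =
      (\<Sum>u\<in>verts G. \<Sum>v\<in>verts G. \<Sum>e\<in>edges G. of_bool (e = {u, v}))"
    using finE by (intro sum.cong refl) (simp add: adj_def of_bool_def)
  also have "\<dots> = (\<Sum>e\<in>edges G. \<Sum>u\<in>verts G. \<Sum>v\<in>verts G. of_bool (e = {u, v}))"
    by (subst (2) sum.swap, subst sum.swap) (rule refl)
  finally show ?thesis by (simp add: one)
qed

lemma zero_one_form_adj:
  "simple_graph G \<Longrightarrow> zero_one_form (verts G) (adj G) (real (card (edges G)))"
  by unfold_locales (auto simp: simple_graph_def adj_self adj_sym sum_adj, auto simp: adj_def)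

lemma num_C4_lower_bound_pos:
  assumes \<epsilon>: "0 < \<epsilon>" "\<epsilon> \<le> 1"
  shows "\<exists>M. \<forall>G :: 'a sgraph. simple_graph G \<and> M \<le> real (card (edges G)) \<and>
    largest_eigenvalue G > sqrt (real (card (edges G))) \<longrightarrow>
    (1 - \<epsilon>) * (real (card (edges G)))\<^sup>2 \<le> 8 * real (num_C4 G)"
proof -
  \<comment> \<open>\<open>s\<close> makes the loss \<open>10 * s\<close> equal to
    \<open>\<epsilon>\<close>. \<open>\<tau>\<close> keeps \<open>14 * \<tau>\<close> below
    \<open>\<epsilon>\<close> and \<open>2 * \<tau>\<close> at most 1/200, the tolerance of
    \<open>star_bound\<close>.\<close>
  define s \<tau> where "s = \<epsilon> / 10" and "\<tau> = \<epsilon> / 400"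
  define L where "L = 1 / s\<^sup>2"
  have pos: "0 < s" "0 < \<tau>" "s \<le> 1 / 2" "\<tau> \<le> 1 / 12" "\<tau> \<le> 1 / 2" "\<tau> \<le> 1 / 400"
    using \<epsilon> by (auto simp: s_def \<tau>_def)
  define M where "M = 16 + 4 * (64 * L / \<tau> ^ 4)\<^sup>2 / \<tau>\<^sup>2"
  have M16: "16 \<le> M" unfolding M_def by simp
  have "(1 - \<epsilon>) * (real (card (edges G)))\<^sup>2 \<le> 8 * real (num_C4 G)"
    if G: "simple_graph G" and mM: "M \<le> real (card (edges G))"
      and ev: "largest_eigenvalue G > sqrt (real (card (edges G)))" for G :: "'a sgraph"
  proof -
    define V m lam where "V = verts G" and "m = real (card (edges G))"
      and "lam = largest_eigenvalue G"
    interpret zero_one_form V "adj G" m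
      unfolding V_def m_def by (rule zero_one_form_adj[OF G])
    have cod: "codeg G = cdeg" unfolding codeg_def cdeg_def by (intro ext) simp
    have m16: "16 \<le> m" using mM M16 by (simp add: m_def)
    have "sqrt m < lam" using ev by (simp add: m_def lam_def)
    moreover have "0 \<le> sqrt m" using m16 by simp
    ultimately have lam0: "0 < lam" by linarith
    have lam2: "m < lam\<^sup>2" using \<open>sqrt m < lam\<close> lam0 by (meson not_le real_le_rsqrt)
    have "V \<noteq> {}" using sum_deg m16 by auto
    then have "eigenvalue (adj_matrix G) lam"
      unfolding lam_def V_def by (rule eigenvalue_largest_eigenvalue[OF G])
    then obtain x0 where nz: "\<exists>u\<in>V. x0 u \<noteq> 0"
      and eig0: "\<And>u. u \<in> V \<Longrightarrow> (\<Sum>v\<in>V. adj G u v * x0 v) = lam * x0 u"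
      unfolding eigenvalue_adj_matrix_iff[OF G] V_def by blast
    define N where "N = sqrt (\<Sum>u\<in>V. (x0 u)\<^sup>2)"
    have pos0: "0 < (\<Sum>u\<in>V. (x0 u)\<^sup>2)"
    proof -
      obtain u where "u \<in> V" "x0 u \<noteq> 0" using nz by blast
      then show ?thesis using finite_V by (intro sum_pos2[of _ u]) auto
    qed
    then have N: "0 < N" "N\<^sup>2 = (\<Sum>u\<in>V. (x0 u)\<^sup>2)" by (auto simp: N_def)
    define x where "x u = x0 u / N" for u
    have eig: "(\<Sum>v\<in>V. adj G u v * x v) = lam * x u" if "u \<in> V" for u
      using eig0[OF that] by (simp add: x_def flip: sum_divide_distrib)
    have unit: "(\<Sum>u\<in>V. (x u)\<^sup>2) = 1"
      using N pos0 by (simp add: x_def power_divide flip: sum_divide_distrib)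
    have "\<exists>v\<in>V. \<forall>u\<in>V. \<bar>x u\<bar> \<le> \<bar>x v\<bar>"
    proof -
      have "Max ((\<lambda>u. \<bar>x u\<bar>) ` V) \<in> (\<lambda>u. \<bar>x u\<bar>) ` V"
        using finite_V \<open>V \<noteq> {}\<close> by (intro Max_in) auto
      then obtain v where "v \<in> V" "Max ((\<lambda>u. \<bar>x u\<bar>) ` V) = \<bar>x v\<bar>" by auto
      then show ?thesis using finite_V by (metis Max_ge finite_imageI imageI)
    qed
    then obtain v where v: "v \<in> V" "\<And>u. u \<in> V \<Longrightarrow> \<bar>x u\<bar> \<le> \<bar>x v\<bar>" by blast
    have "(1 - \<epsilon>) * m\<^sup>2 \<le> 8 * real (num_C4 G)"
    proof (cases "(x v)\<^sup>2 \<le> s\<^sup>2")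
      case True
      have small: "(x u)\<^sup>2 \<le> s\<^sup>2" if "u \<in> V" for u
        using v(2)[OF that] True by (meson abs_le_square_iff order.trans)
      obtain S where "S \<subseteq> V"
        "(1 - 10 * s) * m\<^sup>2 \<le> (\<Sum>u\<in>V. \<Sum>v\<in>V - {u}. (cdeg S u v)\<^sup>2 - cdeg S u v)"
        by (rule spread_eigenvector_bound[of x lam s]) (use eig unit small pos m16 lam2 in auto)
      then show ?thesis
        using sum_codeg_le_num_C4(1)[OF G, of V S] unfolding cod by (simp add: V_def s_def)
    next
      case False
      then have xv: "s\<^sup>2 < (x v)\<^sup>2" "x v \<noteq> 0" using pos(1) by auto
      \<comment> \<open>Absolute values give a nonnegative vector with maximum 1 at
        \<open>v\<close>. By the triangle inequality it satisfies the eigenvalue equation as an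
        inequality, which is all that \<open>concentrated_structure\<close> asks for.\<close>
      define y where "y u = \<bar>x u\<bar> / \<bar>x v\<bar>" for u
      have sub: "lam * y u \<le> (\<Sum>w\<in>V. adj G u w * y w)" if "u \<in> V" for u
      proof -
        have "lam * \<bar>x u\<bar> = \<bar>\<Sum>w\<in>V. adj G u w * x w\<bar>"
          using eig[OF that] lam0 by (simp add: abs_mult)
        also have "\<dots> \<le> (\<Sum>w\<in>V. \<bar>adj G u w * x w\<bar>)" by (rule sum_abs)
        also have "\<dots> = (\<Sum>w\<in>V. adj G u w * \<bar>x w\<bar>)" by (simp add: abs_mult a_nonneg)
        finally show ?thesis
          using xv(2) by (simp add: y_def divide_right_mono flip: sum_divide_distrib)
      qed
      have "(\<Sum>u\<in>V. (y u)\<^sup>2) = 1 / (x v)\<^sup>2"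
        unfolding y_def power_divide power2_abs sum_divide_distrib[symmetric] unit ..
      also have "\<dots> \<le> L"
        unfolding L_def using xv pos(1) by (intro divide_left_mono) auto
      finally have yL: "(\<Sum>u\<in>V. (y u)\<^sup>2) \<le> L" .
      have m4: "4 * (64 * L / \<tau> ^ 4)\<^sup>2 \<le> \<tau>\<^sup>2 * m"
      proof -
        have "4 * (64 * L / \<tau> ^ 4)\<^sup>2 / \<tau>\<^sup>2 \<le> m" using mM by (simp add: M_def m_def)
        then show ?thesis using pos(2) by (simp add: pos_divide_le_eq mult.commute)
      qed
      obtain T where T: "T \<subseteq> V" "v \<in> T" "4 * (real (card T))\<^sup>2 \<le> \<tau>\<^sup>2 * m"
          "(\<Sum>t\<in>T. deg t) \<le> m + \<tau>\<^sup>2 * m / 4"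
          "\<And>u. u \<in> T \<Longrightarrow> (1 - 2 * \<tau>) * m \<le> (\<Sum>t\<in>T. cdeg V u t)"
      proof (rule concentrated_structure[of v y lam L \<tau>])
        show "y u \<le> 1" if "u \<in> V" for u using v(2)[OF that] xv(2) by (simp add: y_def)
      qed (use v(1) xv(2) sub yL lam0 lam2 pos m4 in \<open>auto simp: y_def\<close>)
      have finT: "finite T" using T(1) finite_V by (rule finite_subset)
      \<comment> \<open>A single vertex in \<open>T\<close> would have degree at least
        \<open>(1 - 2 * \<tau>) * m\<close>. \<open>star_bound\<close> needs a true eigenvector,
        hence \<open>x0\<close> instead of \<open>y\<close>.\<close>
      have "2 \<le> card T"
      proof (rule ccontr)
        assume "\<not> 2 \<le> card T"
        then have "card T = 1"
          using T(2) finT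
          by (metis One_nat_def card_gt_0_iff empty_iff less_2_cases_iff not_le less_irrefl)
        then have "T = {v}" using T(2) by (metis card_1_singletonE singletonD)
        then have "(1 - 2 * \<tau>) * m \<le> deg v" using T(5)[OF T(2)] by (simp add: cdeg_self)
        moreover have "199 / 200 * m \<le> (1 - 2 * \<tau>) * m"
          using pos m16 by (intro mult_right_mono) auto
        ultimately have "lam\<^sup>2 \<le> m"
          by (intro star_bound[of v x0 lam] v(1) eig0 nz lam0 m16) auto
        then show False using lam2 by simp
      qed
      \<comment> \<open>Since \<open>T\<close> and \<open>V - T\<close> are disjoint, a cycle is
        counted at most four times, and half of \<open>m\<^sup>2\<close> yields the constant
        1/8.\<close>
      from large_codegrees_bound[OF T(1) this T(3,4,5) pos(2,4)]
      have "(1 - 14 * \<tau>) / 2 * m\<^sup>2 \<le> 4 * real (num_C4 G)"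
        using sum_codeg_le_num_C4(2)[OF G, of T "V - T"] T(1) unfolding cod by (force simp: V_def)
      moreover have "(1 - \<epsilon>) * m\<^sup>2 \<le> (1 - 14 * \<tau>) * m\<^sup>2"
        using \<epsilon> by (intro mult_right_mono) (auto simp: \<tau>_def)
      ultimately show ?thesis by simp
    qed
    then show ?thesis by (simp add: m_def)
  qed
  then show ?thesis by blast
qed

subsection \<open>Extremal graphs\<close>

text \<open>The join of \<open>K\<^sub>2\<close> (vertices 0, 1) with \<open>t\<close> independent vertices, together with a disjoint edge
  if \<open>b\<close> holds, which adjusts the parity of the number of edges.\<close>

definition book :: "nat \<Rightarrow> bool \<Rightarrow> nat sgraph" where
  "book t b = ({..<t + 4}, (\<lambda>l. {0, l}) ` {1..<t + 2} \<union> (\<lambda>l. {1, l}) ` {2..<t + 2} \<union>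
     (if b then {{t + 2, t + 3}} else {}))"

lemma simple_graph_book: "simple_graph (book t b)"
  unfolding simple_graph_def book_def by (auto split: if_splits)

lemma card_edges_book: "card (edges (book t b)) = 2 * t + 1 + of_bool b"
proof -
  let ?A = "(\<lambda>l. {0, l}) ` {1..<t + 2}" and ?B = "(\<lambda>l. {1, l}) ` {2..<t + 2}"
  let ?C = "if b then {{t + 2, t + 3}} else {}"
  have "card ?A = t + 1" "card ?B = t" "card ?C = of_bool b"
    by (subst card_image; auto simp: inj_on_def doubleton_eq_iff)+ auto
  moreover have "?A \<inter> ?B = {}" "(?A \<union> ?B) \<inter> ?C = {}"
  proof -
    have "\<forall>e\<in>?A. 0 \<in> e" "\<forall>e\<in>?B. 0 \<notin> e \<and> 1 \<in> e" "\<forall>e\<in>?C. 0 \<notin> e \<and> 1 \<notin> e" by auto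
    then show "?A \<inter> ?B = {}" "(?A \<union> ?B) \<inter> ?C = {}" by blast+
  qed
  ultimately show ?thesis
    unfolding book_def by (simp add: card_Un_disjoint)
qed

lemma edge_book_iff:
  "{u, v} \<in> edges (book t b) \<longleftrightarrow> u \<noteq> v \<and> ((u < 2 \<or> v < 2) \<and> u < t + 2 \<and> v < t + 2 \<or>
     b \<and> (u = t + 2 \<and> v = t + 3 \<or> u = t + 3 \<and> v = t + 2))"
proof -
  have "{u, v} \<in> (\<lambda>l. {0, l}) ` {1..<t + 2} \<longleftrightarrow> u = 0 \<and> 1 \<le> v \<and> v < t + 2 \<or> v = 0 \<and> 1 \<le> u \<and> u < t + 2"
    by (auto simp: doubleton_eq_iff)
  moreover have "{u, v} \<in> (\<lambda>l. {1, l}) ` {2..<t + 2} \<longleftrightarrow> u = 1 \<and> 2 \<le> v \<and> v < t + 2 \<or> v = 1 \<and> 2 \<le> u \<and> u < t + 2"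
    unfolding image_iff Bex_def atLeastLessThan_iff doubleton_eq_iff by blast
  moreover have "{u, v} \<in> (if b then {{t + 2, t + 3}} else {}) \<longleftrightarrow>
      b \<and> (u = t + 2 \<and> v = t + 3 \<or> u = t + 3 \<and> v = t + 2)"
    by (auto simp: doubleton_eq_iff)
  ultimately have eq: "{u, v} \<in> edges (book t b) \<longleftrightarrow>
      (u = 0 \<and> 1 \<le> v \<and> v < t + 2 \<or> v = 0 \<and> 1 \<le> u \<and> u < t + 2) \<or>
      (u = 1 \<and> 2 \<le> v \<and> v < t + 2 \<or> v = 1 \<and> 2 \<le> u \<and> u < t + 2) \<or>
      b \<and> (u = t + 2 \<and> v = t + 3 \<or> u = t + 3 \<and> v = t + 2)"
    unfolding book_def by auto
  have "u = 0 \<or> u = 1 \<or> 2 \<le> u" "v = 0 \<or> v = 1 \<or> 2 \<le> v" by linarith+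
  then show ?thesis unfolding eq by (elim disjE) auto
qed

text \<open>The vector with \<open>lam\<close> on the two hubs and 2 on the independent vertices is
  an eigenvector: a hub sees \<open>lam + 2 * t\<close>, an independent vertex sees
  \<open>2 * lam\<close>. As \<open>lam > 2\<close>, its square exceeds even
  \<open>2 * t + 2\<close>.\<close>

lemma largest_eigenvalue_book:
  assumes "2 \<le> t"
  shows "sqrt (real (card (edges (book t b)))) < largest_eigenvalue (book t b)"
proof -
  define lam where "lam = (1 + sqrt (1 + 8 * real t)) / 2"
  have "sqrt (1 + 8 * real t) > 3" using assms by (intro real_less_rsqrt) simp
  then have lam2: "lam > 2" by (simp add: lam_def)
  have lam: "lam * lam = lam + 2 * real t"
    by (simp add: lam_def field_simps)
  define x where "x u = (if u < 2 then lam else if u < t + 2 then 2 else 0)" for u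
  have V: "verts (book t b) = {0, 1} \<union> {2..<t + 2} \<union> {t + 2, t + 3}"
    by (auto simp: book_def)
  have split: "(\<Sum>v\<in>verts (book t b). f v) =
      f 0 + f 1 + (\<Sum>v\<in>{2..<t + 2}. f v) + (f (t + 2) + f (t + 3))" for f :: "nat \<Rightarrow> real"
    unfolding V by (subst sum.union_disjoint; force?)+
  have "(\<Sum>v\<in>verts (book t b). adj (book t b) u v * x v) = lam * x u" if u: "u \<in> verts (book t b)" for u
  proof -
    have "adj (book t b) u v * x v = (if u < 2 then 2 else 0)" if "v \<in> {2..<t + 2}" for v
      using that by (auto simp: adj_def edge_book_iff x_def)
    then have "(\<Sum>v\<in>{2..<t + 2}. adj (book t b) u v * x v) = (if u < 2 then 2 * real t else 0)"
      by simp
    then show ?thesis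
      unfolding split using lam
      by (auto simp: adj_def edge_book_iff x_def less_2_cases_iff)
  qed
  moreover have "x 0 \<noteq> 0" "0 \<in> verts (book t b)" using lam2 by (auto simp: x_def book_def)
  ultimately have "eigenvalue (adj_matrix (book t b)) lam"
    unfolding eigenvalue_adj_matrix_iff[OF simple_graph_book] by blast
  then have "lam \<le> largest_eigenvalue (book t b)" by (rule eigenvalue_le_largest_eigenvalue)
  moreover have "sqrt (real (card (edges (book t b)))) < lam"
  proof (rule real_less_lsqrt)
    show "real (card (edges (book t b))) < lam\<^sup>2"
      using lam lam2 unfolding card_edges_book power2_eq_square by (cases b) auto
  qed (use lam2 in auto)
  ultimately show ?thesis by linarith
qed

text \<open>Every edge of the join meets a hub, and two vertices meeting all edges of a 4-cycle are
  opposite. So the other two vertices determine the cycle.\<close>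

lemma num_C4_book: "num_C4 (book t b) \<le> t choose 2"
proof -
  let ?F = "\<lambda>e. ({0, 1} \<union> e, {{h, l} | h l. h \<in> {0, 1} \<and> l \<in> e})"
  let ?P = "{e. e \<subseteq> {2..<t + 2} \<and> card e = 2}"
  have "{H. subgraph H (book t b) \<and> graph_iso H C4} \<subseteq> ?F ` ?P"
  proof
    fix H assume "H \<in> {H. subgraph H (book t b) \<and> graph_iso H C4}"
    then obtain u w v z where H: "H = cycle4 u w v z" and d: "distinct [u, w, v, z]"
      and e: "{u, w} \<in> edges (book t b)" "{w, v} \<in> edges (book t b)"
        "{v, z} \<in> edges (book t b)" "{z, u} \<in> edges (book t b)"
      unfolding C4_copies_eq[OF simple_graph_book] by blast
    \<comment> \<open>A vertex on a cycle has two distinct neighbours, which excludes the ends of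
      the extra edge.\<close>
    have lt: "u < t + 2 \<and> w < t + 2 \<and> v < t + 2 \<and> z < t + 2"
      using d e unfolding edge_book_iff by auto
    have hub: "u < 2 \<or> w < 2" "w < 2 \<or> v < 2" "v < 2 \<or> z < 2" "z < 2 \<or> u < 2"
      using e lt unfolding edge_book_iff by auto
    have "(u = 0 \<and> v = 1 \<or> u = 1 \<and> v = 0) \<and> 2 \<le> w \<and> 2 \<le> z \<or>
        (w = 0 \<and> z = 1 \<or> w = 1 \<and> z = 0) \<and> 2 \<le> u \<and> 2 \<le> v"
    proof -
      have lt2: "n < 2 \<longleftrightarrow> n = 0 \<or> n = 1" and ge2: "2 \<le> n \<longleftrightarrow> n \<noteq> 0 \<and> n \<noteq> 1" for n :: nat by auto
      show ?thesis using hub d unfolding lt2 ge2 by auto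
    qed
    then show "H \<in> ?F ` ?P"
    proof (elim disjE conjE)
      assume "2 \<le> w" "2 \<le> z" and uv: "u = 0" "v = 1"
      then have "{w, z} \<in> ?P" using d lt by auto
      moreover have "H = ?F {w, z}" unfolding H cycle4_def uv by auto
      ultimately show ?thesis by blast
    next
      assume "2 \<le> w" "2 \<le> z" and uv: "u = 1" "v = 0"
      then have "{w, z} \<in> ?P" using d lt by auto
      moreover have "H = ?F {w, z}" unfolding H cycle4_def uv by auto
      ultimately show ?thesis by blast
    next
      assume "2 \<le> u" "2 \<le> v" and wz: "w = 0" "z = 1"
      then have "{u, v} \<in> ?P" using d lt by auto
      moreover have "H = ?F {u, v}" unfolding H cycle4_def wz by auto
      ultimately show ?thesis by blast
    next
      assume "2 \<le> u" "2 \<le> v" and wz: "w = 1" "z = 0"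
      then have "{u, v} \<in> ?P" using d lt by auto
      moreover have "H = ?F {u, v}" unfolding H cycle4_def wz by auto
      ultimately show ?thesis by blast
    qed
  qed
  then have "num_C4 (book t b) \<le> card (?F ` ?P)"
    unfolding num_C4_def by (intro card_mono finite_imageI) auto
  also have "\<dots> \<le> card ?P" by (intro card_image_le) auto
  also have "\<dots> = t choose 2" by (simp add: n_subsets)
  finally show ?thesis .
qed

lemma min_C4_upper_bound:
  assumes m: "5 \<le> m"
  shows "real (min_C4 m) \<le> real m ^ 2 / 8"
    and "{num_C4 G | G :: nat sgraph. simple_graph G \<and> card (edges G) = m \<and>
      largest_eigenvalue G > sqrt (real m)} \<noteq> {}" (is "?S \<noteq> {}")
proof -
  \<comment> \<open>Odd \<open>m\<close> is \<open>2 * t + 1\<close>, and even \<open>m\<close> is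
    \<open>2 * t + 2\<close> with the extra edge; \<open>5 \<le> m\<close> ensures
    \<open>2 \<le> t\<close>.\<close>
  define t where "t = (m - 1) div 2"
  let ?G = "book t (even m)"
  have t: "2 \<le> t" "2 * t \<le> m" using m by (auto simp: t_def)
  have card: "card (edges ?G) = m"
    unfolding card_edges_book t_def using m by (cases "even m") (auto elim!: evenE oddE)
  then have mem: "num_C4 ?G \<in> ?S"
    using simple_graph_book[of t "even m"] largest_eigenvalue_book[OF t(1), of "even m"]
    unfolding mem_Collect_eq by (intro exI[of _ ?G]) simp
  then show "?S \<noteq> {}" by blast
  have "min_C4 m \<le> num_C4 ?G"
    unfolding min_C4_def using mem by (rule wellorder_Inf_le1)
  also have "\<dots> \<le> t choose 2" by (rule num_C4_book)
  finally have "real (min_C4 m) \<le> real (t choose 2)" by simp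
  also have "\<dots> \<le> real t ^ 2 / 2"
  proof -
    have "2 * (t choose 2) \<le> t * (t - 1)" unfolding choose_two by simp
    also have "\<dots> \<le> t * t" by simp
    finally have "real (2 * (t choose 2)) \<le> real (t * t)" by (rule of_nat_mono)
    then show ?thesis by (simp add: power2_eq_square)
  qed
  also have "\<dots> \<le> (real m / 2) ^ 2 / 2"
    using t(2) by (intro divide_right_mono power_mono) auto
  finally show "real (min_C4 m) \<le> real m ^ 2 / 8" by (simp add: power_divide)
qed

section \<open>Passage to the limit\<close>

lemma num_C4_lower_bound:
  assumes \<epsilon>: "0 < \<epsilon>"
  shows "\<exists>M. \<forall>m\<ge>M. \<forall>G :: 'a sgraph. simple_graph G \<and> card (edges G) = m \<and>
    largest_eigenvalue G > sqrt (real m) \<longrightarrow> (1 / 8 - \<epsilon>) * real m ^ 2 \<le> real (num_C4 G)"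
proof -
  define e where "e = min \<epsilon> 1"
  have e: "0 < e" "e \<le> 1" "e \<le> 8 * \<epsilon>" using \<epsilon> by (auto simp: e_def)
  obtain M where M: "\<And>G :: 'a sgraph. simple_graph G \<Longrightarrow> M \<le> real (card (edges G)) \<Longrightarrow>
      largest_eigenvalue G > sqrt (real (card (edges G))) \<Longrightarrow>
      (1 - e) * (real (card (edges G)))\<^sup>2 \<le> 8 * real (num_C4 G)"
    using num_C4_lower_bound_pos[OF e(1,2)] by blast
  have "(1 / 8 - \<epsilon>) * real m ^ 2 \<le> real (num_C4 G)"
    if "nat \<lceil>M\<rceil> \<le> m" "simple_graph G" "card (edges G) = m" "largest_eigenvalue G > sqrt (real m)"
    for m and G :: "'a sgraph"
  proof -
    have "M \<le> real m" using that(1) by linarith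
    then have "(1 - e) * (real m)\<^sup>2 \<le> 8 * real (num_C4 G)" using M[OF that(2)] that(3,4) by simp
    moreover have "(1 - 8 * \<epsilon>) * (real m)\<^sup>2 \<le> (1 - e) * (real m)\<^sup>2"
      using e(3) by (intro mult_right_mono) auto
    ultimately show ?thesis by (simp add: algebra_simps)
  qed
  then show ?thesis by blast
qed

theorem theorem1p6:
  shows "(\<exists>r :: nat \<Rightarrow> real. r \<longlonglongrightarrow> 0 \<and>
           (\<forall>m>0. \<forall>G :: 'a sgraph.
              simple_graph G \<and> card (edges G) = m \<and> largest_eigenvalue G > sqrt (real m) \<longrightarrow>
              real (num_C4 G) \<ge> (1 / 8 - r m) * real m ^ 2)) \<and>
         (\<lambda>m. real (min_C4 m) / real m ^ 2) \<longlonglongrightarrow> 1 / 8"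
proof (intro conjI)
  define good where "good m G \<longleftrightarrow> simple_graph G \<and> card (edges G) = m \<and>
    largest_eigenvalue G > sqrt (real m)" for m and G :: "'a sgraph"
  define g where "g m = Inf (num_C4 ` Collect (good m))" for m
  \<comment> \<open>The positive part of the deficit of the minimum \<open>g m\<close>. The value 0
    covers those \<open>m\<close> without an admissible graph over the given vertex type, where the
    infimum is unspecified.\<close>
  define r where "r m = (if \<exists>G. good m G then max 0 (1 / 8 - real (g m) / real m ^ 2) else 0)" for m
  have "r \<longlonglongrightarrow> 0"
  proof (rule LIMSEQ_I)
    fix \<epsilon> :: real assume "0 < \<epsilon>"
    then obtain M where M: "\<And>m G. M \<le> m \<Longrightarrow> good m G \<Longrightarrow> (1 / 8 - \<epsilon> / 2) * real m ^ 2 \<le> real (num_C4 G)"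
      using num_C4_lower_bound[of "\<epsilon> / 2", where ?'a = 'a] unfolding good_def by (metis half_gt_zero)
    have "norm (r m - 0) < \<epsilon>" if m: "max M 1 \<le> m" for m
    proof (cases "\<exists>G. good m G")
      case True
      then have "g m \<in> num_C4 ` Collect (good m)" unfolding g_def by (intro Inf_nat_def1) auto
      then obtain G where G: "good m G" "g m = num_C4 G" by auto
      have "1 / 8 - \<epsilon> / 2 \<le> real (g m) / real m ^ 2"
        using M[OF _ G(1)] m by (simp add: G(2) pos_le_divide_eq)
      then show ?thesis using \<open>0 < \<epsilon>\<close> by (auto simp: r_def)
    qed (use \<open>0 < \<epsilon>\<close> in \<open>simp add: r_def\<close>)
    then show "\<exists>no. \<forall>n\<ge>no. norm (r n - 0) < \<epsilon>" by blast
  qed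
  moreover have "(1 / 8 - r m) * real m ^ 2 \<le> real (num_C4 G)" if "0 < m" "good m G" for m G
  proof -
    have "r m = max 0 (1 / 8 - real (g m) / real m ^ 2)"
      unfolding r_def using that(2) by (intro if_P) blast
    then have "(1 / 8 - r m) * real m ^ 2 \<le> real (g m) / real m ^ 2 * real m ^ 2"
      by (intro mult_right_mono) auto
    also have "\<dots> = real (g m)" using that(1) by simp
    also have "g m \<le> num_C4 G" unfolding g_def using that(2) by (intro wellorder_Inf_le1) auto
    finally show ?thesis by simp
  qed
  ultimately show "\<exists>r :: nat \<Rightarrow> real. r \<longlonglongrightarrow> 0 \<and>
           (\<forall>m>0. \<forall>G :: 'a sgraph.
              simple_graph G \<and> card (edges G) = m \<and> largest_eigenvalue G > sqrt (real m) \<longrightarrow>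
              real (num_C4 G) \<ge> (1 / 8 - r m) * real m ^ 2)"
    unfolding good_def by blast
  show "(\<lambda>m. real (min_C4 m) / real m ^ 2) \<longlonglongrightarrow> 1 / 8"
  proof (rule LIMSEQ_I)
    fix \<epsilon> :: real assume "0 < \<epsilon>"
    then obtain M where M: "\<And>m (G :: nat sgraph). M \<le> m \<Longrightarrow> simple_graph G \<Longrightarrow> card (edges G) = m \<Longrightarrow>
        largest_eigenvalue G > sqrt (real m) \<Longrightarrow> (1 / 8 - \<epsilon> / 2) * real m ^ 2 \<le> real (num_C4 G)"
      using num_C4_lower_bound[of "\<epsilon> / 2", where ?'a = nat] by (metis half_gt_zero)
    have "norm (real (min_C4 m) / real m ^ 2 - 1 / 8) < \<epsilon>" if m: "max M 5 \<le> m" for m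
    proof -
      \<comment> \<open>The book graphs make the set nonempty, so the infimum is attained and the
        bound for all admissible graphs applies to it.\<close>
      have "min_C4 m \<in> {num_C4 G | G :: nat sgraph. simple_graph G \<and> card (edges G) = m \<and>
          largest_eigenvalue G > sqrt (real m)}"
        unfolding min_C4_def using m by (intro Inf_nat_def1 min_C4_upper_bound(2)) simp
      then have "(1 / 8 - \<epsilon> / 2) * real m ^ 2 \<le> real (min_C4 m)" using M m by auto
      then have "1 / 8 - \<epsilon> / 2 \<le> real (min_C4 m) / real m ^ 2" using m by (simp add: pos_le_divide_eq)
      moreover have "real (min_C4 m) / real m ^ 2 \<le> 1 / 8"
        using min_C4_upper_bound(1)[of m] m by (simp add: pos_divide_le_eq)
      ultimately show ?thesis using \<open>0 < \<epsilon>\<close> unfolding real_norm_def by linarith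
    qed
    then show "\<exists>no. \<forall>n\<ge>no. norm (real (min_C4 n) / real n ^ 2 - 1 / 8) < \<epsilon>" by blast
  qed
qed

end
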